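(* Let $n,K\ge 1$, let the exponential family $(P_\theta)_{\theta\in\Theta}$, the function $f$, the localizing schemes $W^{(1)},\dots,W^{(K)}$, the estimates $\widetilde\theta^{(k)}$, the aggregated estimates $\widehat\theta^{(k)}$ and $\widehat\theta=\widehat\theta^{(K)}$ be as in the context, satisfying (A1), (A2) and (A3). Let $r>0$, $\alpha>0$, and let the critical values $\mathfrak z_k>0$ used in the aggregation procedure satisfy the propagation condition $$\sup_{\theta^*\in\Theta}\mathbf E_{\theta^*}\bigl|N_k\,\mathscr K(\widetilde\theta^{(k)},\widehat\theta^{(k)})\bigr|^r\le\alpha\tau_r,\qquad k=2,\dots,K,\qquad \tau_r:=2r\,\Gamma(r).$$ Let $k^*\in\{1,\dots,K\}$, $\theta\in\Theta$ and $\Delta\ge 0$ be such that $$\max_{k\le k^*}\Delta(W^{(k)},\theta)\le\Delta .$$ Then $$\mathbf E_{f(\cdot)}\bigl|N_{k^*}\mathscr K(\widetilde\theta^{(k^* )},\widehat\theta)\bigr|^{r/2}\le 2^{(r-1)_+}\,\varkappa^r\Bigl\{\sqrt{\alpha\tau_r e^{\Delta}}+\bigl(c_u^2\,\overline{\mathfrak z}_{k^*}\bigr)^{r/2}\Bigr\},$$ where $c_u=(u^{-1/2}-1)^{-1}$ and $\overline{\mathfrak z}_{k}=\max_{k\le l\le K}\mathfrak z_l$.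
   Context: Model. $X_1,\dots,X_n\in\mathbb R^d$ are deterministic design points, and $Y_1,\dots,Y_n$ are independent real random variables with $Y_i\sim P_{f(X_i)}$, where $f:\mathbb R^d\to\Theta$ is an unknown function. $\mathbf P_{f(\cdot)},\mathbf E_{f(\cdot)}$ denote the joint law and expectation; $\mathbf P_\theta,\mathbf E_\theta$ denote those when $f\equiv\theta$. (A1) $(P_\theta,\theta\in\Theta\subseteq\mathbb R)$ is dominated by a measure $P$ with densities $p(y,\theta)=p(y)e^{yC(\theta)-B(\theta)}$, where $p(y)\ge 0$, $B,C$ are nondecreasing continuously differentiable functions on $\Theta$, and $\mathbf E_\theta Y=\theta$ for all $\theta\in\Theta$ (natural parametrization). (A2) $\Theta$ is compact and convex, and the Fisher information $I(\theta)=\mathbf E_\theta|\partial\log p(Y,\theta)/\partial\theta|^2$ is positive and satisfies, for some $\varkappa\ge 1$, $|I(\theta')/I(\theta'')|^{1/2}\le\varkappa$ for all $\theta',\theta''\in\Theta$. $\mathscr K(\theta,\theta')=\mathbf E_\theta\log\{p(Y,\theta)/p(Y,\theta')\}$ is the Kullback–Leibler divergence. Localizing schemes and weak estimates. For a fixed point $x$, deterministic weights $W^{(k)}=(w_1^{(k)},\dots,w_n^{(k)})$ with $w_i^{(k)}\in[0,1]$, $k=1,\dots,K$, are given; $N_k=\sum_{i=1}^n w_i^{(k)}>0$. The local likelihood estimates are $\widetilde\theta^{(k)}=\arg\max_{\theta\in\Theta}\sum_i w_i^{(k)}\log p(Y_i,\theta)$ (equal to $\sum_i w_i^{(k)}Y_i/N_k$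 whenever the latter lies in $\Theta$). (A3) $w_i^{(k)}\ge w_i^{(k')}$ for all $i$ and all $k>k'$, and for constants $0<u_0\le u<1$, $u_0\le N_{k-1}/N_k\le u$ for every $2\le k\le K$. Modeling bias. For weights $W=(w_i)$, $\Delta(W,\theta)=\sum_i\delta(\theta,f(X_i))\mathbf 1(w_i>0)$, where $\delta(\theta,\theta')=\log \mathbf E_\theta\{p^2(Y,\theta')/p^2(Y,\theta)\}$, $Y\sim P_\theta$. Aggregation procedure (SSA). $K_{\mathrm{ag}}:[0,\infty)\to[0,1]$ is a fixed nonincreasing kernel, supported on $[0,1]$, with $K_{\mathrm{ag}}(t)=1$ for $t\le b$ for some fixed $b>0$. Given $\mathfrak z_k>0$: $\widehat\theta^{(1)}=\widetilde\theta^{(1)}$; for $k=2,\dots,K$, $\widehat\theta^{(k)}=\gamma_k\widetilde\theta^{(k)}+(1-\gamma_k)\widehat\theta^{(k-1)}$ with $\gamma_k=K_{\mathrm{ag}}(\mathbf m^{(k)}/\mathfrak z_k)$, $\mathbf m^{(k)}=N_k\mathscr K(\widetilde\theta^{(k)},\widehat\theta^{(k-1)})$. The final estimate is $\widehat\theta=\widehat\theta^{(K)}$. $(a)_+=\max(a,0)$. *)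

theory Defs
  imports "HOL-Probability.Probability"
begin

text \<open>
  Throughout, \<open>P\<close> is the dominating measure on the real line, \<open>q y t\<close> is the density
  \<open>p(y,t)\<close> of \<open>P\<^sub>t\<close> with respect to \<open>P\<close>, and \<open>\<Theta>\<close> is the parameter set.  Observations are
  indexed by \<open>{1..n}\<close> and scales by \<open>{1..K}\<close>; \<open>w k i\<close> is the weight of observation \<open>i\<close> at
  scale \<open>k\<close>.
\<close>

definition law :: "real measure \<Rightarrow> (real \<Rightarrow> real \<Rightarrow> real) \<Rightarrow> real \<Rightarrow> real measure" where
  "law P q t = density P (\<lambda>y. ennreal (q y t))"

definition joint_law ::
  "real measure \<Rightarrow> (real \<Rightarrow> real \<Rightarrow> real) \<Rightarrow> nat \<Rightarrow> (nat \<Rightarrow> real) \<Rightarrow> (nat \<Rightarrow> real) measure" where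
  "joint_law P q n g = PiM {1..n} (\<lambda>i. law P q (g i))"

text \<open>
  Derivatives are taken within \<open>\<Theta>\<close> (one-sided at the end points), since the family is only
  given on \<open>\<Theta>\<close>; hence not \<open>C1_differentiable_on\<close>, which takes two-sided derivatives.
\<close>

definition cont_diff_on :: "(real \<Rightarrow> real) \<Rightarrow> real set \<Rightarrow> bool" where
  "cont_diff_on g S \<longleftrightarrow>
     (\<exists>g'. continuous_on S g' \<and> (\<forall>t\<in>S. (g has_real_derivative g' t) (at t within S)))"

definition cond_A1 :: "real measure \<Rightarrow> (real \<Rightarrow> real \<Rightarrow> real) \<Rightarrow> real set \<Rightarrow> bool" where
  "cond_A1 P q \<Theta> \<longleftrightarrow>
     sets P = sets borel \<and>
     (\<exists>p B C. p \<in> borel_measurable borel \<and> (\<forall>y. 0 \<le> p y) \<and>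
        mono_on \<Theta> B \<and> mono_on \<Theta> C \<and> cont_diff_on B \<Theta> \<and> cont_diff_on C \<Theta> \<and>
        (\<forall>t\<in>\<Theta>. \<forall>y. q y t = p y * exp (y * C t - B t))) \<and>
     (\<forall>t\<in>\<Theta>. prob_space (law P q t)) \<and>
     (\<forall>t\<in>\<Theta>. integrable (law P q t) (\<lambda>y. y) \<and> (\<integral>y. y \<partial>law P q t) = t)"

text \<open>
  A non-integrable score gives the Bochner value \<open>0\<close>, which the positivity requirement in
  \<open>cond_A2\<close> excludes, so that \<open>cond_A2\<close> includes finiteness of the information.
\<close>

definition fisher_info ::
  "real measure \<Rightarrow> (real \<Rightarrow> real \<Rightarrow> real) \<Rightarrow> real set \<Rightarrow> real \<Rightarrow> real" where
  "fisher_info P q \<Theta> t =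
     (\<integral>y. \<bar>vector_derivative (\<lambda>s. ln (q y s)) (at t within \<Theta>)\<bar>\<^sup>2 \<partial>law P q t)"

definition cond_A2 ::
  "real measure \<Rightarrow> (real \<Rightarrow> real \<Rightarrow> real) \<Rightarrow> real set \<Rightarrow> real \<Rightarrow> bool" where
  "cond_A2 P q \<Theta> \<kappa> \<longleftrightarrow>
     compact \<Theta> \<and> convex \<Theta> \<and> 1 \<le> \<kappa> \<and>
     (\<forall>t\<in>\<Theta>. 0 < fisher_info P q \<Theta> t) \<and>
     (\<forall>t\<in>\<Theta>. \<forall>s\<in>\<Theta>. sqrt \<bar>fisher_info P q \<Theta> t / fisher_info P q \<Theta> s\<bar> \<le> \<kappa>)"

definition KL :: "real measure \<Rightarrow> (real \<Rightarrow> real \<Rightarrow> real) \<Rightarrow> real \<Rightarrow> real \<Rightarrow> real" where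
  "KL P q t s = (\<integral>y. ln (q y t / q y s) \<partial>law P q t)"

definition weight_sum :: "nat \<Rightarrow> (nat \<Rightarrow> real) \<Rightarrow> real" where
  "weight_sum n W = (\<Sum>i=1..n. W i)"

definition localizing_schemes :: "nat \<Rightarrow> nat \<Rightarrow> (nat \<Rightarrow> nat \<Rightarrow> real) \<Rightarrow> bool" where
  "localizing_schemes n K w \<longleftrightarrow>
     (\<forall>k\<in>{1..K}. (\<forall>i\<in>{1..n}. 0 \<le> w k i \<and> w k i \<le> 1) \<and> 0 < weight_sum n (w k))"

definition cond_A3 :: "nat \<Rightarrow> nat \<Rightarrow> (nat \<Rightarrow> nat \<Rightarrow> real) \<Rightarrow> real \<Rightarrow> real \<Rightarrow> bool" where
  "cond_A3 n K w u0 u \<longleftrightarrow>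
     (\<forall>i\<in>{1..n}. \<forall>k\<in>{1..K}. \<forall>k'\<in>{1..K}. k' < k \<longrightarrow> w k' i \<le> w k i) \<and>
     0 < u0 \<and> u0 \<le> u \<and> u < 1 \<and>
     (\<forall>k\<in>{2..K}. u0 \<le> weight_sum n (w (k - 1)) / weight_sum n (w k) \<and>
                  weight_sum n (w (k - 1)) / weight_sum n (w k) \<le> u)"

definition local_mle ::
  "(real \<Rightarrow> real \<Rightarrow> real) \<Rightarrow> real set \<Rightarrow> nat \<Rightarrow> (nat \<Rightarrow> real) \<Rightarrow> (nat \<Rightarrow> real) \<Rightarrow> real" where
  "local_mle q \<Theta> n W Y = arg_max_on (\<lambda>t. \<Sum>i=1..n. W i * ln (q (Y i) t)) \<Theta>"

text \<open>
  The second moment of the likelihood ratio may be infinite, in which case \<open>delta\<close> is \<open>\<infinity>\<close>.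
\<close>

definition delta :: "real measure \<Rightarrow> (real \<Rightarrow> real \<Rightarrow> real) \<Rightarrow> real \<Rightarrow> real \<Rightarrow> ereal" where
  "delta P q t s =
     (let m = \<integral>\<^sup>+y. ennreal ((q y s)\<^sup>2 / (q y t)\<^sup>2) \<partial>law P q t
      in if m = \<infinity> then \<infinity> else ereal (ln (enn2real m)))"

definition modeling_bias ::
  "real measure \<Rightarrow> (real \<Rightarrow> real \<Rightarrow> real) \<Rightarrow> nat \<Rightarrow> (nat \<Rightarrow> real) \<Rightarrow> (nat \<Rightarrow> real) \<Rightarrow> real \<Rightarrow> ereal"
  where
  "modeling_bias P q n g W t = (\<Sum>i \<in> {i \<in> {1..n}. 0 < W i}. delta P q t (g i))"

definition agg_kernel :: "(real \<Rightarrow> real) \<Rightarrow> real \<Rightarrow> bool" where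
  "agg_kernel Kag b \<longleftrightarrow>
     antimono_on {0..} Kag \<and> (\<forall>t\<ge>0. 0 \<le> Kag t \<and> Kag t \<le> 1) \<and> (\<forall>t>1. Kag t = 0) \<and>
     0 < b \<and> (\<forall>t. 0 \<le> t \<and> t \<le> b \<longrightarrow> Kag t = 1)"

text \<open>Scales start at \<open>1\<close>; the value at scale \<open>0\<close> is a dummy.\<close>

primrec agg_est ::
  "real measure \<Rightarrow> (real \<Rightarrow> real \<Rightarrow> real) \<Rightarrow> real set \<Rightarrow> nat \<Rightarrow> (nat \<Rightarrow> nat \<Rightarrow> real) \<Rightarrow>
   (real \<Rightarrow> real) \<Rightarrow> (nat \<Rightarrow> real) \<Rightarrow> nat \<Rightarrow> (nat \<Rightarrow> real) \<Rightarrow> real" where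
  "agg_est P q \<Theta> n w Kag z 0 Y = local_mle q \<Theta> n (w 1) Y"
| "agg_est P q \<Theta> n w Kag z (Suc k) Y =
     (if k = 0 then local_mle q \<Theta> n (w 1) Y
      else let weak = local_mle q \<Theta> n (w (Suc k)) Y;
               prev = agg_est P q \<Theta> n w Kag z k Y;
               m = weight_sum n (w (Suc k)) * KL P q weak prev;
               \<gamma> = Kag (m / z (Suc k))
           in \<gamma> * weak + (1 - \<gamma>) * prev)"

definition tau :: "real \<Rightarrow> real" where
  "tau r = 2 * r * Gamma r"

definition propagation_condition ::
  "real measure \<Rightarrow> (real \<Rightarrow> real \<Rightarrow> real) \<Rightarrow> real set \<Rightarrow> nat \<Rightarrow> nat \<Rightarrow> (nat \<Rightarrow> nat \<Rightarrow> real) \<Rightarrow>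
   (real \<Rightarrow> real) \<Rightarrow> (nat \<Rightarrow> real) \<Rightarrow> real \<Rightarrow> real \<Rightarrow> bool" where
  "propagation_condition P q \<Theta> n K w Kag z r \<alpha> \<longleftrightarrow>
     (\<forall>k\<in>{2..K}.
        (SUP t\<in>\<Theta>. \<integral>\<^sup>+Y. ennreal (\<bar>weight_sum n (w k) *
              KL P q (local_mle q \<Theta> n (w k) Y) (agg_est P q \<Theta> n w Kag z k Y)\<bar> powr r)
            \<partial>joint_law P q n (\<lambda>_. t))
        \<le> ennreal (\<alpha> * tau r))"

definition c_u :: "real \<Rightarrow> real" where
  "c_u u = inverse (u powr (-1/2) - 1)"

definition zbar :: "nat \<Rightarrow> (nat \<Rightarrow> real) \<Rightarrow> nat \<Rightarrow> real" where
  "zbar K z k = Max (z ` {k..K})"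

end

theory Submission
  imports Defs
begin

text \<open>
  On the interior of \<open>\<Theta>\<close> the Fisher information equals \<open>C'\<close>, and \<open>B' = t C'\<close>, so that
  \<open>KL(t,s) = t (C t - C s) - (B t - B s)\<close> is the integral of \<open>(v - t) C' v\<close> from \<open>t\<close> to \<open>s\<close>.
  Hence \<open>m (t - s)\<^sup>2 \<le> KL(t,s) \<le> \<kappa>\<^sup>2 m (t - s)\<^sup>2\<close> for some \<open>m > 0\<close>, and \<open>sqrt KL\<close> satisfies a triangle
  inequality with constant \<open>\<kappa>\<close>.  The kernel vanishes beyond \<open>1\<close>, so an aggregation step at
  scale \<open>l\<close> moves the estimate by at most \<open>z\<^sub>l / N\<^sub>l\<close> in divergence; as \<open>N\<^sub>l\<close> grows geometrically,
  the steps after \<open>k*\<close> add up to \<open>c\<^sub>u sqrt zbar\<close>.  What remains is the expectation at scale \<open>k*\<close>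
  under the true law.  The Cauchy--Schwarz inequality bounds it by the propagation condition at
  \<open>\<theta>\<close> times the second moment of the likelihood ratio, and since the statistic only depends on
  the observations of positive weight, that moment is at most \<open>exp \<Delta>\<close>.
\<close>

section \<open>Natural exponential families\<close>

locale natural_exp_family =
  fixes P :: "real measure" and q :: "real \<Rightarrow> real \<Rightarrow> real" and \<Theta> :: "real set"
    and p B C B' C' :: "real \<Rightarrow> real"
  assumes sets_P: "sets P = sets borel"
    and p_measurable: "p \<in> borel_measurable borel"
    and p_nonneg: "0 \<le> p y"
    and B_mono: "mono_on \<Theta> B" and C_mono: "mono_on \<Theta> C"
    and B_deriv: "t \<in> \<Theta> \<Longrightarrow> (B has_real_derivative B' t) (at t within \<Theta>)"
    and C_deriv: "t \<in> \<Theta> \<Longrightarrow> (C has_real_derivative C' t) (at t within \<Theta>)"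
    and B'_cont: "continuous_on \<Theta> B'" and C'_cont: "continuous_on \<Theta> C'"
    and q_eq: "t \<in> \<Theta> \<Longrightarrow> q y t = p y * exp (y * C t - B t)"
    and law_prob: "t \<in> \<Theta> \<Longrightarrow> prob_space (law P q t)"
    and law_integrable: "t \<in> \<Theta> \<Longrightarrow> integrable (law P q t) (\<lambda>y. y)"
    and law_mean: "t \<in> \<Theta> \<Longrightarrow> (\<integral>y. y \<partial>law P q t) = t"
begin

text \<open>\<open>lr t s\<close> is the likelihood ratio of \<open>s\<close> against \<open>t\<close>, without the quotient \<open>0 / 0\<close> at the zeros
  of \<open>p\<close>.\<close>

definition lr :: "real \<Rightarrow> real \<Rightarrow> real \<Rightarrow> real" where
  "lr t s y = exp (y * (C s - C t) - (B s - B t))"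

lemma lr_measurable: "lr t s \<in> borel_measurable borel"
  unfolding lr_def by measurable

lemma lr_pos: "0 < lr t s y"
  by (simp add: lr_def)

lemma measurable_P: "borel_measurable P = borel_measurable borel"
  by (rule measurable_cong_sets) (simp_all add: sets_P)

lemma sets_law: "sets (law P q t) = sets borel"
  by (simp add: law_def sets_P)

lemma measurable_law: "borel_measurable (law P q t) = borel_measurable borel"
  by (rule measurable_cong_sets) (simp_all add: sets_law)

lemma q_measurable: "t \<in> \<Theta> \<Longrightarrow> (\<lambda>y. q y t) \<in> borel_measurable borel"
  using p_measurable by (simp add: q_eq)

lemma q_lr: "t \<in> \<Theta> \<Longrightarrow> s \<in> \<Theta> \<Longrightarrow> q y s = q y t * lr t s y"
  by (simp add: q_eq lr_def mult_exp_exp algebra_simps)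

lemma q_nonneg: "t \<in> \<Theta> \<Longrightarrow> 0 \<le> q y t"
  by (simp add: q_eq p_nonneg)

text \<open>The zeros of \<open>p\<close> carry no mass, so logarithms and quotients of densities,
  with their default values at \<open>0\<close>, matter only where all densities are
  positive.\<close>

lemma AE_law_pos:
  assumes "t \<in> \<Theta>" shows "AE y in law P q t. 0 < p y"
  unfolding law_def using q_measurable[OF assms] p_nonneg
  by (subst AE_density) (auto simp: measurable_P q_eq[OF assms] less_le)

lemma law_change:
  assumes "t \<in> \<Theta>" "s \<in> \<Theta>"
  shows "law P q s = density (law P q t) (\<lambda>y. ennreal (lr t s y))"
  unfolding law_def using assms q_measurable lr_measurable lr_pos q_nonneg
  by (subst density_density_eq)
     (auto simp: measurable_P q_lr[OF assms] ennreal_mult less_imp_le intro!: density_cong)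

lemma integrable_law_change:
  assumes "t \<in> \<Theta>" "s \<in> \<Theta>" and [measurable]: "g \<in> borel_measurable borel"
  shows "integrable (law P q s) g \<longleftrightarrow> integrable (law P q t) (\<lambda>y. lr t s y * g y)"
  unfolding law_change[OF assms(1,2)] using lr_pos lr_measurable
  by (subst integrable_density) (auto simp: measurable_law less_imp_le)

lemma integral_law_change:
  assumes "t \<in> \<Theta>" "s \<in> \<Theta>" and [measurable]: "g \<in> borel_measurable borel"
  shows "(\<integral>y. g y \<partial>law P q s) = (\<integral>y. lr t s y * g y \<partial>law P q t)"
  unfolding law_change[OF assms(1,2)] using lr_pos lr_measurable
  by (subst integral_density) (auto simp: measurable_law less_imp_le)

section \<open>Closed form of the divergence and identifiability\<close>

definition kl :: "real \<Rightarrow> real \<Rightarrow> real" where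
  "kl t s = t * (C t - C s) - (B t - B s)"

text \<open>Off the zeros of \<open>p\<close> the log-likelihood ratio is affine in
  \<open>y\<close>, so its expectation depends on the law only through the mean
  \<open>t\<close>.\<close>

lemma KL_eq_kl:
  assumes t: "t \<in> \<Theta>" and s: "s \<in> \<Theta>"
  shows "KL P q t s = kl t s"
proof -
  interpret prob_space "law P q t" by (rule law_prob[OF t])
  have "KL P q t s = (\<integral>y. y * (C t - C s) - (B t - B s) \<partial>law P q t)"
    unfolding KL_def
  proof (rule integral_cong_AE)
    show "(\<lambda>y. ln (q y t / q y s)) \<in> borel_measurable (law P q t)"
      using q_measurable[OF t] q_measurable[OF s] by (simp add: measurable_law)
    show "(\<lambda>y. y * (C t - C s) - (B t - B s)) \<in> borel_measurable (law P q t)"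
      by (simp add: measurable_law)
    show "AE y in law P q t. ln (q y t / q y s) = y * (C t - C s) - (B t - B s)"
      using AE_law_pos[OF t]
    proof eventually_elim
      case (elim y)
      have "q y t / q y s = exp (y * C t - B t) / exp (y * C s - B s)"
        using elim by (simp add: q_eq t s)
      also have "\<dots> = exp (y * (C t - C s) - (B t - B s))"
        by (simp add: exp_diff[symmetric] algebra_simps)
      finally show ?case by simp
    qed
  qed
  also have "\<dots> = kl t s"
    using law_integrable[OF t] law_mean[OF t] by (simp add: kl_def prob_space)
  finally show ?thesis .
qed

text \<open>If \<open>C t = C s\<close>, the likelihood ratio is constant, and total mass one makes
  it \<open>1\<close>. The two laws then have the same mean, which is the parameter.\<close>

lemma C_inj: "inj_on C \<Theta>"
proof (rule inj_onI)
  fix t s assume t: "t \<in> \<Theta>" and s: "s \<in> \<Theta>" and eq: "C t = C s"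
  interpret T: prob_space "law P q t" by (rule law_prob[OF t])
  interpret S: prob_space "law P q s" by (rule law_prob[OF s])
  have lr: "lr t s y = exp (B t - B s)" for y
    by (simp add: lr_def eq)
  have "1 = exp (B t - B s)"
    using integral_law_change[OF t s, of "\<lambda>_. 1"] by (simp add: lr T.prob_space S.prob_space)
  then show "t = s"
    using integral_law_change[OF t s, of "\<lambda>y. y"] by (simp add: lr law_mean t s)
qed

lemma C_less: "t \<in> \<Theta> \<Longrightarrow> s \<in> \<Theta> \<Longrightarrow> t < s \<Longrightarrow> C t < C s"
  using C_inj C_mono by (metis inj_on_eq_iff less_eq_real_def mono_onD nless_le)

text \<open>Up to a constant factor the integrand is \<open>lr t s\<close>, whose integral is the
  mass of \<open>law P q s\<close>. With \<open>s\<close> at the end points of \<Theta> these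
  exponential moments provide the majorant in \<open>score_moments\<close>.\<close>

lemma integrable_exp_tilt:
  assumes t: "t \<in> \<Theta>" and s: "s \<in> \<Theta>"
  shows "integrable (law P q t) (\<lambda>y. exp (y * (C s - C t)))"
proof -
  interpret S: prob_space "law P q s" by (rule law_prob[OF s])
  have "integrable (law P q t) (\<lambda>y. lr t s y * 1)"
    using integrable_law_change[OF t s, of "\<lambda>_. 1"] by simp
  then have "integrable (law P q t) (\<lambda>y. exp (B s - B t) * (lr t s y * 1))"
    by (rule integrable_mult_right)
  then show ?thesis by (simp add: lr_def mult_exp_exp)
qed

end

section \<open>Exponential bounds and the moments of the score\<close>

lemma square_le_exp:
  fixes u \<eta> :: real
  assumes "0 \<le> u" "0 < \<eta>"
  shows "(1 + u)\<^sup>2 \<le> (1 + 2 / \<eta> + 2 / \<eta>\<^sup>2) * exp (\<eta> * u)"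
proof -
  have e: "1 + \<eta> * u + (\<eta> * u)\<^sup>2 / 2 \<le> exp (\<eta> * u)"
    by (rule exp_lower_Taylor_quadratic) (use assms in simp)
  have p: "0 \<le> \<eta> * u" using assms by simp
  \<comment> \<open>With \<open>v = \<eta> * u\<close>, each of \<open>1\<close>, \<open>v\<close>
    and \<open>v\<^sup>2 / 2\<close> is a term of the Taylor bound \<open>e\<close> and hence at
    most \<open>exp v\<close>.\<close>
  have "(1 + u)\<^sup>2 = 1 + 2 / \<eta> * (\<eta> * u) + 2 / \<eta>\<^sup>2 * ((\<eta> * u)\<^sup>2 / 2)"
    using assms by (simp add: power2_eq_square field_simps)
  also have "\<dots> \<le> 1 * exp (\<eta> * u) + 2 / \<eta> * exp (\<eta> * u) + 2 / \<eta>\<^sup>2 * exp (\<eta> * u)"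
    using e p assms zero_le_power2[of "\<eta> * u"]
    by (intro add_mono mult_left_mono; linarith?) auto
  finally show ?thesis by (simp add: algebra_simps)
qed

text \<open>Both signs of \<open>h\<close> follow from \<open>1 + x \<le> exp x\<close>, taken at
  \<open>- h\<close> and at \<open>h\<close>. The factor linear in \<open>h\<close> keeps the
  difference quotients of \<open>lr\<close> bounded as the step tends to zero.\<close>

lemma abs_exp_minus_one_le:
  fixes h :: real shows "\<bar>exp h - 1\<bar> \<le> \<bar>h\<bar> * (1 + exp h)"
proof (cases "0 \<le> h")
  case True
  have "exp h * (1 - h) \<le> exp h * exp (- h)"
    using exp_ge_add_one_self[of "- h"] by (intro mult_left_mono) auto
  then have "exp h - 1 \<le> h * exp h" by (simp add: exp_minus algebra_simps)
  then show ?thesis using True by (simp add: algebra_simps)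
next
  case False
  have "1 - exp h \<le> - h" using exp_ge_add_one_self[of h] by linarith
  moreover have "0 \<le> - h * exp h" using False by (intro mult_nonneg_nonneg) auto
  moreover have "exp h \<le> 1" using False by simp
  moreover have "\<bar>h\<bar> * (1 + exp h) = - h + - h * exp h" using False by (simp add: algebra_simps)
  ultimately show ?thesis by linarith
qed

text \<open>As \<open>t\<close> is interior, \<eta> is a positive margin on both sides: from
  \<open>C s\<close> up to \<open>C hi\<close> and from \<open>C t\<close> down to
  \<open>C lo\<close>. The growth \<open>exp (\<eta> * \<bar>y\<bar>)\<close> is therefore absorbed
  by the tilt towards \<open>hi\<close> for \<open>y \<ge> 0\<close> and towards \<open>lo\<close>
  for \<open>y < 0\<close>, both integrable under \<open>law P q t\<close>.\<close>

lemma (in natural_exp_family) exp_tilt_dominated: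
  assumes \<Theta>: "\<Theta> = {lo..hi}" and t: "lo < t" "t < hi"
    and s: "s = (t + hi) / 2"
    and \<eta>: "\<eta> = min (C hi - C s) (C t - C lo)"
  shows "0 < \<eta>"
    "exp (\<eta> * \<bar>y\<bar>) * (1 + exp (max 0 y * (C s - C t)))
       \<le> 2 * (exp (y * (C hi - C t)) + exp (y * (C lo - C t)))"
proof -
  have c: "C lo < C t" "C t < C s" "C s < C hi"
    using t by (auto intro!: C_less simp: \<Theta> s)
  then show "0 < \<eta>" by (simp add: \<eta>)
  have *: "exp (\<eta> * \<bar>y\<bar>) * (1 + exp (max 0 y * (C s - C t)))
     \<le> 2 * (exp (\<eta> * \<bar>y\<bar>) * exp (max 0 y * (C s - C t)))"
  proof -
    have "1 \<le> exp (max 0 y * (C s - C t))" using c by simp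
    then show ?thesis by (simp add: algebra_simps)
  qed
  have "exp (\<eta> * \<bar>y\<bar>) * exp (max 0 y * (C s - C t)) \<le> exp (y * (C hi - C t)) + exp (y * (C lo - C t))"
  proof (cases "0 \<le> y")
    case True
    have "\<eta> * \<bar>y\<bar> + max 0 y * (C s - C t) \<le> y * (C hi - C t)"
      using True mult_left_mono[of \<eta> "C hi - C s" y] by (simp add: \<eta> algebra_simps)
    then show ?thesis by (simp add: mult_exp_exp add_increasing2)
  next
    case False
    have "\<eta> * \<bar>y\<bar> + max 0 y * (C s - C t) \<le> y * (C lo - C t)"
      using False mult_left_mono[of \<eta> "C t - C lo" "-y"] by (simp add: \<eta> algebra_simps)
    then show ?thesis by (simp add: mult_exp_exp add_increasing)
  qed
  then show "exp (\<eta> * \<bar>y\<bar>) * (1 + exp (max 0 y * (C s - C t)))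
       \<le> 2 * (exp (y * (C hi - C t)) + exp (y * (C lo - C t)))"
    by (intro order_trans[OF *] mult_left_mono) auto
qed


text \<open>Differentiate \<open>\<integral>L\<^sub>s dP\<^sub>t = 1\<close> and \<open>\<integral>y L\<^sub>s dP\<^sub>t = s\<close> at \<open>s = t\<close>, where \<open>L\<^sub>s = lr t s\<close>: the score
  \<open>S = y C' - B'\<close> has mean \<open>0\<close> and covariance \<open>1\<close> with \<open>y\<close>, whence \<open>E S\<^sup>2 = C'\<close>. Differentiation from
  the right suffices.\<close>

lemma (in natural_exp_family) score_moments:
  assumes \<Theta>: "\<Theta> = {lo..hi}" and t: "lo < t" "t < hi"
  shows "t * C' t = B' t"
    and "(\<integral>y. (y * C' t - B' t)\<^sup>2 \<partial>law P q t) = C' t"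
proof -
  have t\<Theta>: "t \<in> \<Theta>" and lo\<Theta>: "lo \<in> \<Theta>" and hi\<Theta>: "hi \<in> \<Theta>" using t by (auto simp: \<Theta>)
  interpret prob_space "law P q t" by (rule law_prob[OF t\<Theta>])
  \<comment> \<open>The points \<open>s n\<close> decrease to \<open>t\<close> from the midpoint
    \<open>s0\<close> of \<open>t\<close> and \<open>hi\<close>. Lying above \<open>t\<close> makes
    the increments of \<open>B\<close> and \<open>C\<close> nonnegative; lying below
    \<open>s0\<close> leaves the margin \<eta> for the domination.\<close>
  define h where "h n = (hi - t) / 2 / real (Suc n)" for n
  define s where "s n = t + h n" for n
  define s0 where "s0 = (t + hi) / 2"
  have h_pos: "0 < h n" for n using t by (simp add: h_def)
  have h_le: "h n \<le> h 0" for n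
    using t unfolding h_def by (intro divide_left_mono) auto
  have s0: "s 0 = s0" by (simp add: s_def h_def s0_def field_simps)
  have s_gt: "t < s n" for n using h_pos by (simp add: s_def)
  have s_le: "s n \<le> s0" for n using h_le[of n] by (simp add: s0[symmetric] s_def)
  have s0_hi: "s0 < hi" using t by (simp add: s0_def)
  have s\<Theta>: "s n \<in> \<Theta>" for n using t s_gt[of n] s_le[of n] s0_hi by (auto simp: \<Theta>)
  have s0\<Theta>: "s0 \<in> \<Theta>" using s\<Theta>[of 0] by (simp add: s0)
  have "h \<longlonglongrightarrow> 0"
    unfolding h_def by (intro real_tendsto_divide_at_top[OF tendsto_const]
      filterlim_compose[OF filterlim_real_sequentially filterlim_Suc])
  then have "s \<longlonglongrightarrow> t + 0" unfolding s_def by (intro tendsto_intros)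
  then have s_lim: "filterlim s (at t within \<Theta>) sequentially"
    using s_gt s\<Theta> by (simp add: filterlim_at less_imp_neq[symmetric])
  have quot: "(\<lambda>n. (g (s n) - g t) / h n) \<longlonglongrightarrow> D"
    if "(g has_real_derivative D) (at t within \<Theta>)" for g D
    using filterlim_compose[OF that[unfolded has_field_derivative_iff] s_lim]
    by (simp add: s_def)
  obtain RC where RC: "\<And>n. \<bar>(C (s n) - C t) / h n\<bar> \<le> RC"
    using quot[OF C_deriv[OF t\<Theta>], THEN convergentI, THEN convergent_imp_Bseq]
    by (auto simp: Bseq_def)
  obtain RB where RB: "\<And>n. \<bar>(B (s n) - B t) / h n\<bar> \<le> RB"
    using quot[OF B_deriv[OF t\<Theta>], THEN convergentI, THEN convergent_imp_Bseq]
    by (auto simp: Bseq_def)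
  define R where "R = max RC RB"
  have R0: "0 \<le> R" using order_trans[OF abs_ge_zero RC[of 0]] by (simp add: R_def)
  define \<eta> where "\<eta> = min (C hi - C s0) (C t - C lo)"
  define c where "c = 1 + 2 / \<eta> + 2 / \<eta>\<^sup>2"
  \<comment> \<open>\<open>R\<close> bounds the difference quotients of \<open>B\<close> and
    \<open>C\<close>, and \<open>c\<close> absorbs \<open>(1 + \<bar>y\<bar>)\<^sup>2\<close>: one
    factor comes from the test function, the other from the exponent of the likelihood ratio, which
    is affine in \<open>y\<close>.\<close>
  define G where "G y = R * (c * (2 * (exp (y * (C hi - C t)) + exp (y * (C lo - C t)))))" for y
  define D where "D n y = (lr t (s n) y - 1) / h n" for n y
  note fd = exp_tilt_dominated[OF \<Theta> t s0_def \<eta>_def]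
  have c0: "0 \<le> c" using fd(1) by (simp add: c_def)
  have D_bound: "(1 + \<bar>y\<bar>) * \<bar>D n y\<bar> \<le> G y" for n y
  proof -
    let ?a = "C (s n) - C t" and ?b = "B (s n) - B t"
    have a: "0 \<le> ?a" "?a \<le> C s0 - C t"
      using s_gt[of n] s_le[of n] by (auto intro!: mono_onD[OF C_mono] s\<Theta> s0\<Theta> t\<Theta>)
    have b: "0 \<le> ?b" using s_gt[of n] by (auto intro!: mono_onD[OF B_mono] s\<Theta> t\<Theta>)
    have "\<bar>y * ?a - ?b\<bar> / h n = \<bar>y * (?a / h n) - ?b / h n\<bar>"
      using h_pos[of n] by (simp add: diff_divide_distrib[symmetric])
    also have "\<dots> \<le> \<bar>y\<bar> * \<bar>?a / h n\<bar> + \<bar>?b / h n\<bar>"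
      by (metis abs_mult abs_triangle_ineq4)
    also have "\<dots> \<le> \<bar>y\<bar> * R + R"
      using RC[of n] RB[of n] by (intro add_mono mult_left_mono) (auto simp: R_def)
    finally have lin: "\<bar>y * ?a - ?b\<bar> / h n \<le> R * (1 + \<bar>y\<bar>)" by (simp add: algebra_simps)
    have "y * ?a - ?b \<le> max 0 y * (C s0 - C t)"
    proof (cases "0 \<le> y")
      case True
      then have "y * ?a \<le> y * (C s0 - C t)" using a by (intro mult_left_mono) auto
      then show ?thesis using True b by simp
    next
      case False
      then have "y * ?a \<le> 0" using a by (intro mult_nonpos_nonneg) auto
      then show ?thesis using False b by simp
    qed
    then have ex: "lr t (s n) y \<le> exp (max 0 y * (C s0 - C t))" by (simp add: lr_def)
    have "\<bar>D n y\<bar> = \<bar>lr t (s n) y - 1\<bar> / h n" using h_pos[of n] by (simp add: D_def)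
    also have "\<dots> \<le> \<bar>y * ?a - ?b\<bar> * (1 + lr t (s n) y) / h n"
      unfolding lr_def using h_pos[of n] by (intro divide_right_mono abs_exp_minus_one_le) simp
    also have "\<dots> = \<bar>y * ?a - ?b\<bar> / h n * (1 + lr t (s n) y)" by simp
    also have "\<dots> \<le> R * (1 + \<bar>y\<bar>) * (1 + exp (max 0 y * (C s0 - C t)))"
      using lin ex R0 lr_pos[of t "s n" y] by (intro mult_mono) auto
    finally have "(1 + \<bar>y\<bar>) * \<bar>D n y\<bar> \<le> (1 + \<bar>y\<bar>) * (R * (1 + \<bar>y\<bar>) * (1 + exp (max 0 y * (C s0 - C t))))"
      by (intro mult_left_mono) auto
    also have "\<dots> = R * ((1 + \<bar>y\<bar>)\<^sup>2 * (1 + exp (max 0 y * (C s0 - C t))))"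
      by (simp add: power2_eq_square)
    also have "\<dots> \<le> R * ((c * exp (\<eta> * \<bar>y\<bar>)) * (1 + exp (max 0 y * (C s0 - C t))))"
      unfolding c_def using fd(1) R0
      by (intro mult_left_mono mult_right_mono square_le_exp) (auto simp: add_nonneg_nonneg)
    also have "\<dots> = R * (c * (exp (\<eta> * \<bar>y\<bar>) * (1 + exp (max 0 y * (C s0 - C t)))))"
      by simp
    also have "\<dots> \<le> G y"
      unfolding G_def using R0 c0 by (intro mult_left_mono fd(2)) auto
    finally show ?thesis .
  qed
  have G_int: "integrable (law P q t) G"
    unfolding G_def
    by (intro integrable_mult_right Bochner_Integration.integrable_add integrable_exp_tilt t\<Theta> lo\<Theta> hi\<Theta>)
  have D_lim: "(\<lambda>n. D n y) \<longlonglongrightarrow> y * C' t - B' t" for y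
  proof -
    have "((\<lambda>s. lr t s y) has_real_derivative (y * C' t - B' t) * lr t t y) (at t within \<Theta>)"
      unfolding lr_def
      by (rule derivative_eq_intros C_deriv B_deriv t\<Theta> refl | simp)+
    from quot[OF this] show ?thesis by (simp add: D_def lr_def)
  qed
  have D_meas: "D n \<in> borel_measurable borel" for n
    unfolding D_def using lr_measurable by measurable
  \<comment> \<open>The test functions will be \<open>g = 1\<close> and \<open>g = y\<close>; both
    obey the growth bound that \<open>D_bound\<close> allows.\<close>
  have dct: "integrable (law P q t) (\<lambda>y. g y * (y * C' t - B' t))"
      "(\<lambda>n. \<integral>y. g y * D n y \<partial>law P q t) \<longlonglongrightarrow> (\<integral>y. g y * (y * C' t - B' t) \<partial>law P q t)"
    if [measurable]: "g \<in> borel_measurable borel" and g: "\<And>y. \<bar>g y\<bar> \<le> 1 + \<bar>y\<bar>" for g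
  proof -
    have *: "AE y in law P q t. (\<lambda>n. g y * D n y) \<longlonglongrightarrow> g y * (y * C' t - B' t)"
      by (intro AE_I2 tendsto_intros D_lim)
    have **: "AE y in law P q t. norm (g y * D n y) \<le> G y" for n
    proof (intro AE_I2)
      fix y
      have "norm (g y * D n y) \<le> (1 + \<bar>y\<bar>) * \<bar>D n y\<bar>"
        unfolding real_norm_def abs_mult by (intro mult_right_mono g) simp
      with D_bound[of y n] show "norm (g y * D n y) \<le> G y" by linarith
    qed
    have m: "(\<lambda>y. g y * (y * C' t - B' t)) \<in> borel_measurable (law P q t)"
        "\<And>n. (\<lambda>y. g y * D n y) \<in> borel_measurable (law P q t)"
      using D_meas by (simp_all add: measurable_law)
    show "integrable (law P q t) (\<lambda>y. g y * (y * C' t - B' t))"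
      using m G_int * ** by (rule integrable_dominated_convergence)
    show "(\<lambda>n. \<integral>y. g y * D n y \<partial>law P q t) \<longlonglongrightarrow> (\<integral>y. g y * (y * C' t - B' t) \<partial>law P q t)"
      using m G_int * ** by (rule integral_dominated_convergence)
  qed
  \<comment> \<open>By the change of law this is the difference quotient of the mean of
    \<open>g\<close>, which is \<open>0\<close> for \<open>g = 1\<close> and \<open>1\<close> for
    \<open>g = y\<close>.\<close>
  have int: "(\<integral>y. g y * D n y \<partial>law P q t) = ((\<integral>y. g y \<partial>law P q (s n)) - (\<integral>y. g y \<partial>law P q t)) / h n"
    if [measurable]: "g \<in> borel_measurable borel" and g: "\<And>s. s \<in> \<Theta> \<Longrightarrow> integrable (law P q s) g" for g n
  proof -
    have i: "integrable (law P q t) (\<lambda>y. lr t (s n) y * g y)"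
      using g[OF s\<Theta>] by (simp add: integrable_law_change[OF t\<Theta> s\<Theta>])
    have "(\<integral>y. g y * D n y \<partial>law P q t) = (\<integral>y. (lr t (s n) y * g y - g y) / h n \<partial>law P q t)"
      by (simp add: D_def algebra_simps)
    also have "\<dots> = ((\<integral>y. lr t (s n) y * g y \<partial>law P q t) - (\<integral>y. g y \<partial>law P q t)) / h n"
      using i g[OF t\<Theta>] by simp
    finally show ?thesis by (simp add: integral_law_change[OF t\<Theta> s\<Theta>])
  qed
  have int1: "(\<integral>y. 1 * D n y \<partial>law P q t) = 0" for n
  proof -
    interpret S: prob_space "law P q (s n)" by (rule law_prob[OF s\<Theta>])
    have "integrable (law P q u) (\<lambda>_. 1 :: real)" if "u \<in> \<Theta>" for u
    proof -
      interpret U: prob_space "law P q u" by (rule law_prob[OF that])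
      show ?thesis by simp
    qed
    from int[OF _ this, of n] show ?thesis by (simp add: prob_space S.prob_space)
  qed
  have int2: "(\<integral>y. y * D n y \<partial>law P q t) = 1" for n
    using int[of "\<lambda>y. y" n] h_pos[of n] law_integrable
    by (simp add: law_mean t\<Theta> s\<Theta>) (simp add: s_def)
  have e1: "(\<integral>y. y * C' t - B' t \<partial>law P q t) = 0"
    using dct(2)[of "\<lambda>_. 1"] int1 by (simp add: LIMSEQ_const_iff)
  have e2: "(\<integral>y. y * (y * C' t - B' t) \<partial>law P q t) = 1"
    using dct(2)[of "\<lambda>y. y"] int2 by (simp add: LIMSEQ_const_iff)
  have i1: "integrable (law P q t) (\<lambda>y. y * C' t - B' t)"
    using dct(1)[of "\<lambda>_. 1"] by simp
  have i2: "integrable (law P q t) (\<lambda>y. y * (y * C' t - B' t))"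
    by (rule dct(1)) auto
  show "t * C' t = B' t"
    using e1 law_integrable[OF t\<Theta>] law_mean[OF t\<Theta>] by (simp add: prob_space)
  \<comment> \<open>The two products on the right integrate to \<open>C' t\<close> and
    \<open>0\<close> by \<open>e2\<close> and \<open>e1\<close>.\<close>
  have sq: "(y * C' t - B' t)\<^sup>2 = C' t * (y * (y * C' t - B' t)) - B' t * (y * C' t - B' t)" for y
    by (simp add: power2_eq_square algebra_simps)
  show "(\<integral>y. (y * C' t - B' t)\<^sup>2 \<partial>law P q t) = C' t"
    unfolding sq Bochner_Integration.integral_diff[OF integrable_mult_right[OF i2] integrable_mult_right[OF i1]]
    by (simp add: integral_mult_right_zero e1 e2 del: integral_diff Bochner_Integration.integral_diff)
qed

text \<open>Almost surely the score is \<open>y * C' t - B' t\<close>, whose second moment is known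
  from \<open>score_moments\<close>.\<close>

lemma (in natural_exp_family) fisher_info_eq:
  assumes \<Theta>: "\<Theta> = {lo..hi}" and t: "lo < t" "t < hi"
  shows "fisher_info P q \<Theta> t = C' t"
proof -
  have t\<Theta>: "t \<in> \<Theta>" using t by (simp add: \<Theta>)
  \<comment> \<open>At a zero of \<open>p\<close> the function is constantly the default
    \<open>ln 0 = 0\<close>; the value is recorded because measurability of the score concerns every
    \<open>y\<close>. The derivative within \<Theta> is unique because the interval is
    nondegenerate.\<close>
  have vd: "vector_derivative (\<lambda>s. ln (q y s)) (at t within \<Theta>) = (if 0 < p y then y * C' t - B' t else 0)" for y
  proof -
    have "((\<lambda>s. ln (q y s)) has_real_derivative (if 0 < p y then y * C' t - B' t else 0)) (at t within \<Theta>)"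
    proof (cases "0 < p y")
      case True
      have "((\<lambda>s. ln (p y) + (y * C s - B s)) has_real_derivative y * C' t - B' t) (at t within \<Theta>)"
        by (rule derivative_eq_intros C_deriv B_deriv t\<Theta> refl | simp)+
      then have "((\<lambda>s. ln (q y s)) has_real_derivative y * C' t - B' t) (at t within \<Theta>)"
        by (rule has_field_derivative_transform_within[OF _ zero_less_one t\<Theta>]) (simp add: q_eq ln_mult_pos True)
      then show ?thesis using True by simp
    next
      case False
      then have "p y = 0" using p_nonneg[of y] by simp
      have "((\<lambda>s. ln (q y s)) has_real_derivative 0) (at t within \<Theta>)"
        by (rule has_field_derivative_transform_within[OF DERIV_const[of 0] zero_less_one t\<Theta>]) (simp add: q_eq \<open>p y = 0\<close>)
      then show ?thesis using False by simp
    qed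
    then show ?thesis
      unfolding \<Theta> has_real_derivative_iff_has_vector_derivative
      using t by (intro vector_derivative_within_closed_interval) auto
  qed
  have "fisher_info P q \<Theta> t = (\<integral>y. (y * C' t - B' t)\<^sup>2 \<partial>law P q t)"
    unfolding fisher_info_def
  proof (rule integral_cong_AE)
    show "(\<lambda>y. \<bar>vector_derivative (\<lambda>s. ln (q y s)) (at t within \<Theta>)\<bar>\<^sup>2) \<in> borel_measurable (law P q t)"
      unfolding vd measurable_law using p_measurable by measurable
    show "(\<lambda>y. (y * C' t - B' t)\<^sup>2) \<in> borel_measurable (law P q t)"
      unfolding measurable_law by measurable
    show "AE y in law P q t. \<bar>vector_derivative (\<lambda>s. ln (q y s)) (at t within \<Theta>)\<bar>\<^sup>2 = (y * C' t - B' t)\<^sup>2"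
      using AE_law_pos[OF t\<Theta>] by eventually_elim (simp add: vd)
  qed
  then show ?thesis using score_moments(2)[OF \<Theta> t] by simp
qed

text \<open>By \<open>B'_eq\<close> the derivative of \<open>kl t v\<close> in \<open>v\<close> is
  \<open>(v - t) * C' v\<close>. Subtracting \<open>c / 2 * (t - v)\<^sup>2\<close> leaves
  \<open>(v - t) * (C' v - c)\<close>, so the mean value theorem reduces both bounds to the sign of
  \<open>C' v - c\<close> at one point.\<close>

lemma (in natural_exp_family) kl_bounds_interval:
  assumes \<Theta>: "\<Theta> = {lo..hi}"
    and B'_eq: "\<And>t. t \<in> \<Theta> \<Longrightarrow> B' t = t * C' t"
    and t: "t \<in> \<Theta>" and s: "s \<in> \<Theta>"
    and m: "\<And>t. t \<in> \<Theta> \<Longrightarrow> m \<le> C' t" and M: "\<And>t. t \<in> \<Theta> \<Longrightarrow> C' t \<le> M"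
  shows "m / 2 * (t - s)\<^sup>2 \<le> kl t s" and "kl t s \<le> M / 2 * (t - s)\<^sup>2"
proof -
  have der: "((\<lambda>v. kl t v - c / 2 * (t - v)\<^sup>2) has_derivative (*) ((v - t) * (C' v - c))) (at v within {a..b})"
    if "v \<in> {a..b}" "a \<in> \<Theta>" "b \<in> \<Theta>" for v a b c
  proof -
    have v: "v \<in> \<Theta>" and sub: "{a..b} \<subseteq> \<Theta>" using that by (auto simp: \<Theta>)
    note d = C_deriv[OF v, THEN has_field_derivative_subset, OF sub]
      B_deriv[OF v, THEN has_field_derivative_subset, OF sub]
    have "((\<lambda>v. kl t v - c / 2 * (t - v)\<^sup>2) has_real_derivative (v - t) * (C' v - c)) (at v within {a..b})"
      unfolding kl_def
      by (rule derivative_eq_intros d refl)+ (simp add: B'_eq[OF v] algebra_simps)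
    then show ?thesis by (simp add: has_field_derivative_def)
  qed
  have zero: "kl t t = 0" by (simp add: kl_def)
  \<comment> \<open>The factor \<open>d\<close> is \<open>(v - t) * (s - t)\<close>, nonnegative
    because \<open>v\<close> lies between \<open>t\<close> and \<open>s\<close>.\<close>
  have key: "\<exists>v\<in>\<Theta>. \<exists>d\<ge>0. kl t s - c / 2 * (t - s)\<^sup>2 = d * (C' v - c)" for c
  proof (cases "t \<le> s")
    case True
    obtain v where v: "v \<in> {t..s}"
      "kl t s - c / 2 * (t - s)\<^sup>2 - (kl t t - c / 2 * (t - t)\<^sup>2) = (v - t) * (C' v - c) * (s - t)"
      using mvt_very_simple[OF True der[OF _ t s]] by (metis atLeastAtMost_iff)
    show ?thesis
      using v t s True mult_nonneg_nonneg[of "v - t" "s - t"]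
      by (intro bexI[of _ v] exI[of _ "(v - t) * (s - t)"]) (auto simp: zero \<Theta>)
  next
    case False
    then have st: "s \<le> t" by simp
    obtain v where v: "v \<in> {s..t}"
      "kl t t - c / 2 * (t - t)\<^sup>2 - (kl t s - c / 2 * (t - s)\<^sup>2) = (v - t) * (C' v - c) * (t - s)"
      using mvt_very_simple[OF st der[OF _ s t]] by (metis atLeastAtMost_iff)
    have "kl t s - c / 2 * (t - s)\<^sup>2 = (t - v) * (t - s) * (C' v - c)"
      using v(2) by (simp add: zero algebra_simps)
    moreover have "0 \<le> (t - v) * (t - s)" using v(1) st by (intro mult_nonneg_nonneg) auto
    moreover have "v \<in> \<Theta>" using v(1) t s by (auto simp: \<Theta>)
    ultimately show ?thesis by blast
  qed
  show "m / 2 * (t - s)\<^sup>2 \<le> kl t s"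
    using key[of m] m by (smt (verit) mult_nonneg_nonneg)
  show "kl t s \<le> M / 2 * (t - s)\<^sup>2"
    using key[of M] M by (smt (verit) mult_nonneg_nonpos)
qed

section \<open>Divergence and weak estimates\<close>

text \<open>The divergence is comparable with a squared distance. The quotient of the two constants
  is \<open>\<kappa>\<^sup>2\<close>, which becomes \<open>\<kappa> powr r\<close> in the final
  bound.\<close>

locale regular_exp_family = natural_exp_family +
  fixes lo hi m \<kappa> :: real
  assumes \<Theta>_eq: "\<Theta> = {lo..hi}" and lo_le_hi: "lo \<le> hi" and m_pos: "0 < m" and \<kappa>_ge_1: "1 \<le> \<kappa>"
    and kl_lower: "t \<in> \<Theta> \<Longrightarrow> s \<in> \<Theta> \<Longrightarrow> m * (t - s)\<^sup>2 \<le> kl t s"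
    and kl_upper: "t \<in> \<Theta> \<Longrightarrow> s \<in> \<Theta> \<Longrightarrow> kl t s \<le> \<kappa>\<^sup>2 * m * (t - s)\<^sup>2"

text \<open>At the end points of \<open>\<Theta>\<close> the identities \<open>I = C'\<close> and \<open>B' = t C'\<close> are replaced by a passage to the
  limit. If \<open>\<Theta>\<close> is a single point, derivatives within \<open>\<Theta>\<close> are meaningless, but the conclusion is
  trivial.\<close>

lemma regular_exp_family_of_conds:
  assumes A1: "cond_A1 P q \<Theta>" and A2: "cond_A2 P q \<Theta> \<kappa>" and ne: "\<Theta> \<noteq> {}"
  obtains p B C B' C' lo hi m where "regular_exp_family P q \<Theta> p B C B' C' lo hi m \<kappa>"
proof -
  obtain p B C where pBC: "sets P = sets borel" "p \<in> borel_measurable borel" "\<forall>y. 0 \<le> p y"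
     "mono_on \<Theta> B" "mono_on \<Theta> C" "cont_diff_on B \<Theta>" "cont_diff_on C \<Theta>"
     "\<forall>t\<in>\<Theta>. \<forall>y. q y t = p y * exp (y * C t - B t)"
    using A1 unfolding cond_A1_def by blast
  obtain B' C' where der: "continuous_on \<Theta> B'" "\<forall>t\<in>\<Theta>. (B has_real_derivative B' t) (at t within \<Theta>)"
      "continuous_on \<Theta> C'" "\<forall>t\<in>\<Theta>. (C has_real_derivative C' t) (at t within \<Theta>)"
    using pBC unfolding cont_diff_on_def by blast
  have laws: "\<forall>t\<in>\<Theta>. prob_space (law P q t)"
      "\<forall>t\<in>\<Theta>. integrable (law P q t) (\<lambda>y. y) \<and> (\<integral>y. y \<partial>law P q t) = t"
    using A1 unfolding cond_A1_def by blast+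
  interpret natural_exp_family P q \<Theta> p B C B' C'
    by (rule natural_exp_family.intro) (use pBC der laws in blast)+
  obtain lo hi where \<Theta>: "\<Theta> = {lo..hi}"
    using A2 connected_convex_1 connected_compact_interval_1 unfolding cond_A2_def by metis
  have \<kappa>: "1 \<le> \<kappa>" and fpos: "\<And>t. t \<in> \<Theta> \<Longrightarrow> 0 < fisher_info P q \<Theta> t"
    and frat: "\<And>t s. t \<in> \<Theta> \<Longrightarrow> s \<in> \<Theta> \<Longrightarrow> sqrt \<bar>fisher_info P q \<Theta> t / fisher_info P q \<Theta> s\<bar> \<le> \<kappa>"
    using A2 unfolding cond_A2_def by blast+
  have "\<exists>m>0. \<forall>t\<in>\<Theta>. \<forall>s\<in>\<Theta>. m * (t - s)\<^sup>2 \<le> kl t s \<and> kl t s \<le> \<kappa>\<^sup>2 * m * (t - s)\<^sup>2"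
  proof (cases "lo < hi")
    case False
    then have "t = s" if "t \<in> \<Theta>" "s \<in> \<Theta>" for t s
      using that by (auto simp: \<Theta>)
    then have "m * (t - s)\<^sup>2 \<le> kl t s \<and> kl t s \<le> \<kappa>\<^sup>2 * m * (t - s)\<^sup>2"
      if "t \<in> \<Theta>" "s \<in> \<Theta>" for m t s
      using that by (metis kl_def diff_self mult_zero_right order_refl zero_power2)
    then show ?thesis using zero_less_one by blast
  next
    case True
    have cl: "closure {lo<..<hi} = \<Theta>" using True by (simp add: \<Theta>)
    have B'_eq: "B' t = t * C' t" if "t \<in> \<Theta>" for t
    proof -
      have "t * C' t - B' t = 0"
        by (rule continuous_constant_on_closure[where S = "{lo<..<hi}" and f = "\<lambda>t. t * C' t - B' t"])
           (use that score_moments(1)[OF \<Theta>] B'_cont C'_cont in \<open>auto simp: cl intro!: continuous_intros\<close>)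
      then show ?thesis by simp
    qed
    have pos: "0 < C' t" if "t \<in> {lo<..<hi}" for t
      using that fpos[of t] fisher_info_eq[OF \<Theta>, of t] by (simp add: \<Theta>)
    have ratio: "C' t \<le> \<kappa>\<^sup>2 * C' s" if t: "t \<in> {lo<..<hi}" and s: "s \<in> {lo<..<hi}" for t s
    proof -
      have "sqrt \<bar>C' t / C' s\<bar> \<le> \<kappa>"
        using t s frat[of t s] fisher_info_eq[OF \<Theta>, of t] fisher_info_eq[OF \<Theta>, of s] by (simp add: \<Theta>)
      then have "\<bar>C' t / C' s\<bar> \<le> \<kappa>\<^sup>2" by (rule sqrt_le_D)
      then show ?thesis using pos[OF t] pos[OF s] by (simp add: field_simps)
    qed
    \<comment> \<open>The comparison reaches the end points by continuity, one argument at a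
      time.\<close>
    have ratio': "C' t \<le> \<kappa>\<^sup>2 * C' s" if t: "t \<in> \<Theta>" and s: "s \<in> {lo<..<hi}" for t s
      by (rule continuous_le_on_closure[where S = "{lo<..<hi}" and f = C'])
         (use that ratio C'_cont in \<open>auto simp: cl\<close>)
    have ratio'': "C' t \<le> \<kappa>\<^sup>2 * C' s" if t: "t \<in> \<Theta>" and s: "s \<in> \<Theta>" for t s
      by (rule continuous_ge_on_closure[where S = "{lo<..<hi}" and f = "\<lambda>s. \<kappa>\<^sup>2 * C' s"])
         (use that ratio' C'_cont in \<open>auto simp: cl intro!: continuous_intros\<close>)
    \<comment> \<open>Half the minimum of \<open>C'\<close> serves as \<open>m\<close>. It is
      positive by comparison with the midpoint, where \<open>C'\<close> is the Fisher
      information.\<close>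
    obtain s0 where s0: "s0 \<in> \<Theta>" "\<And>t. t \<in> \<Theta> \<Longrightarrow> C' s0 \<le> C' t"
      using continuous_attains_inf[OF _ ne C'_cont] \<Theta> by auto
    have mid: "(lo + hi) / 2 \<in> {lo<..<hi}" using True by simp
    have "0 < C' ((lo + hi) / 2)" by (rule pos[OF mid])
    also have "\<dots> \<le> \<kappa>\<^sup>2 * C' s0" using mid s0 by (intro ratio'') (auto simp: \<Theta>)
    finally have "0 < C' s0" using zero_less_mult_pos \<kappa> by fastforce
    then show ?thesis
      using kl_bounds_interval[OF \<Theta> B'_eq _ _ s0(2), of _ _ "\<kappa>\<^sup>2 * C' s0"] ratio'' s0(1)
      by (intro exI[of _ "C' s0 / 2"]) auto
  qed
  then obtain m where "0 < m"
    "\<forall>t\<in>\<Theta>. \<forall>s\<in>\<Theta>. m * (t - s)\<^sup>2 \<le> kl t s \<and> kl t s \<le> \<kappa>\<^sup>2 * m * (t - s)\<^sup>2" by blast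
  then have "regular_exp_family P q \<Theta> p B C B' C' lo hi m \<kappa>"
    using \<kappa> ne \<Theta> by unfold_locales auto
  then show thesis by (rule that)
qed

context regular_exp_family
begin

lemma kl_nonneg: "t \<in> \<Theta> \<Longrightarrow> s \<in> \<Theta> \<Longrightarrow> 0 \<le> kl t s"
  using kl_lower m_pos by (meson mult_nonneg_nonneg order_trans less_imp_le zero_le_power2)

lemma kl_self: "kl t t = 0"
  by (simp add: kl_def)

text \<open>\<open>kl\<close> is the Bregman divergence of \<open>t * C t - B t\<close> with
  gradient \<open>C\<close>, and this is its three-point identity.\<close>

lemma kl_three_point: "kl t s = kl t v + kl v s + (t - v) * (C v - C s)"
  by (simp add: kl_def algebra_simps)

lemma \<Theta>_convex: "t \<in> \<Theta> \<Longrightarrow> s \<in> \<Theta> \<Longrightarrow> 0 \<le> c \<Longrightarrow> c \<le> 1 \<Longrightarrow> c * t + (1 - c) * s \<in> \<Theta>"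
  unfolding \<Theta>_eq using convexD[OF convex_real_interval(5), of t lo hi s c "1 - c"] by simp

text \<open>The convex combination lies between \<open>t\<close> and \<open>s\<close>, so
  monotonicity of \<open>C\<close> makes the cross term of the three-point identity nonnegative.
  This bounds an aggregation step by the divergence between the weak and the previous
  estimate.\<close>

lemma kl_contract:
  assumes t: "t \<in> \<Theta>" and s: "s \<in> \<Theta>" and c: "0 \<le> c" "c \<le> 1"
  shows "kl (c * t + (1 - c) * s) s \<le> kl t s"
proof -
  define v where "v = c * t + (1 - c) * s"
  have v: "v \<in> \<Theta>" unfolding v_def by (rule \<Theta>_convex) fact+
  have tv: "t - v = (1 - c) * (t - s)" and vs: "v - s = c * (t - s)"
    by (simp_all add: v_def algebra_simps)
  have "0 \<le> (t - v) * (C v - C s)"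
  proof (cases "s \<le> t")
    case True
    then have "0 \<le> t - v" "0 \<le> v - s" unfolding tv vs using c by (auto intro!: mult_nonneg_nonneg)
    then show ?thesis using mono_onD[OF C_mono s v] by (intro mult_nonneg_nonneg) auto
  next
    case False
    then have "t - v \<le> 0" "v - s \<le> 0" unfolding tv vs using c by (auto intro!: mult_nonneg_nonpos)
    then show ?thesis using mono_onD[OF C_mono v s] by (intro mult_nonpos_nonpos) auto
  qed
  then show ?thesis
    using kl_three_point[of t s v] kl_nonneg[OF t v] by (simp add: v_def)
qed

section \<open>Projection onto the parameter set and the weak estimates\<close>

definition clamp :: "real \<Rightarrow> real" where
  "clamp x = max lo (min hi x)"

lemma clamp_in: "clamp x \<in> \<Theta>"
  using lo_le_hi by (auto simp: clamp_def \<Theta>_eq)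

lemma clamp_id: "t \<in> \<Theta> \<Longrightarrow> clamp t = t"
  by (auto simp: clamp_def \<Theta>_eq)

text \<open>The difference of the two sides is \<open>kl (clamp x) t + (x - clamp x) (C (clamp x) - C t)\<close>.\<close>

lemma likelihood_less_clamp:
  assumes t: "t \<in> \<Theta>" and ne: "t \<noteq> clamp x"
  shows "x * C t - B t < x * C (clamp x) - B (clamp x)"
proof -
  have "0 < m * (clamp x - t)\<^sup>2" using m_pos ne by simp
  also have "\<dots> \<le> kl (clamp x) t" by (rule kl_lower[OF clamp_in t])
  finally have "0 < kl (clamp x) t" .
  moreover have "0 \<le> (x - clamp x) * (C (clamp x) - C t)"
  proof -
    consider "x < lo" | "hi < x" | "clamp x = x" using lo_le_hi by (fastforce simp: clamp_def)
    then show ?thesis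
    proof cases
      case 1
      then have "clamp x = lo" using lo_le_hi by (simp add: clamp_def)
      then show ?thesis
        using 1 t mono_onD[OF C_mono, of lo t] by (intro mult_nonpos_nonpos) (auto simp: \<Theta>_eq)
    next
      case 2
      then have "clamp x = hi" using lo_le_hi by (simp add: clamp_def)
      then show ?thesis
        using 2 t mono_onD[OF C_mono, of t hi] by (intro mult_nonneg_nonneg) (auto simp: \<Theta>_eq)
    qed simp
  qed
  ultimately show ?thesis by (simp add: kl_def algebra_simps)
qed

text \<open>Summing over the positive weights alone makes the function visibly depend on those
  coordinates only, so it makes sense on any product containing them.\<close>

definition mle :: "nat \<Rightarrow> (nat \<Rightarrow> real) \<Rightarrow> (nat \<Rightarrow> real) \<Rightarrow> real" where
  "mle n W Y = clamp ((\<Sum>i\<in>{i\<in>{1..n}. 0 < W i}. W i * Y i) / weight_sum n W)"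

lemma mle_in: "mle n W Y \<in> \<Theta>"
  by (simp add: mle_def clamp_in)

text \<open>The weighted log-likelihood is an increasing affine function of
  \<open>x * C t - B t\<close>, where \<open>x\<close> is the weighted mean. Its maximizer
  \<open>clamp x\<close> is unique, which determines the value chosen by
  \<open>arg_max_on\<close>.\<close>

lemma local_mle_eq:
  assumes p: "\<And>i. i \<in> {1..n} \<Longrightarrow> 0 < p (Y i)"
    and W: "\<And>i. i \<in> {1..n} \<Longrightarrow> 0 \<le> W i" and N: "0 < weight_sum n W"
  shows "local_mle q \<Theta> n W Y = mle n W Y"
proof -
  define x where "x = (\<Sum>i\<in>{i\<in>{1..n}. 0 < W i}. W i * Y i) / weight_sum n W"
  have S: "(\<Sum>i=1..n. W i * Y i) = weight_sum n W * x"
  proof -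
    have "(\<Sum>i=1..n. W i * Y i) = (\<Sum>i\<in>{i\<in>{1..n}. 0 < W i}. W i * Y i)"
      using W by (intro sum.mono_neutral_right) (auto simp: not_less intro: antisym)
    then show ?thesis using N by (simp add: x_def)
  qed
  define c where "c = (\<Sum>i=1..n. W i * ln (p (Y i)))"
  have L: "(\<Sum>i=1..n. W i * ln (q (Y i) t)) = c + weight_sum n W * (x * C t - B t)" if t: "t \<in> \<Theta>" for t
  proof -
    have "(\<Sum>i=1..n. W i * ln (q (Y i) t)) = (\<Sum>i=1..n. W i * ln (p (Y i)) + C t * (W i * Y i) - B t * W i)"
      using p by (intro sum.cong refl) (simp add: q_eq t ln_mult_pos algebra_simps)
    also have "\<dots> = c + C t * (\<Sum>i=1..n. W i * Y i) - B t * weight_sum n W"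
      by (simp add: c_def sum.distrib sum_subtractf sum_distrib_left weight_sum_def)
    finally show ?thesis unfolding S by (simp add: algebra_simps)
  qed
  have less: "(\<Sum>i=1..n. W i * ln (q (Y i) t)) < (\<Sum>i=1..n. W i * ln (q (Y i) (clamp x)))"
    if "t \<in> \<Theta>" "t \<noteq> clamp x" for t
    unfolding L[OF that(1)] L[OF clamp_in] using likelihood_less_clamp[OF that] N by simp
  have "local_mle q \<Theta> n W Y = clamp x"
    unfolding local_mle_def arg_max_on_def
  proof (rule arg_maxI[of _ "clamp x"])
    fix t assume "t \<in> \<Theta>"
    then show "\<not> (\<Sum>i=1..n. W i * ln (q (Y i) (clamp x))) < (\<Sum>i=1..n. W i * ln (q (Y i) t))"
      using less[of t] by (cases "t = clamp x") auto
  next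
    fix t assume "t \<in> \<Theta>"
      "\<forall>s. s \<in> \<Theta> \<longrightarrow> \<not> (\<Sum>i=1..n. W i * ln (q (Y i) t)) < (\<Sum>i=1..n. W i * ln (q (Y i) s))"
    then show "t = clamp x" using less[of t] clamp_in by blast
  qed (rule clamp_in)
  then show ?thesis by (simp add: mle_def x_def)
qed

section \<open>Measurability and dependence on the weighted observations\<close>

lemma mono_comp_clamp_measurable:
  fixes g :: "real \<Rightarrow> real"
  assumes "mono_on \<Theta> g" "f \<in> borel_measurable M" "\<And>x. f x \<in> \<Theta>"
  shows "(\<lambda>x. g (f x)) \<in> borel_measurable M"
proof -
  \<comment> \<open>Monotonicity is known on \<Theta> only; composing with \<open>clamp\<close>
    extends \<open>g\<close> to a monotone, hence Borel, function on the line.\<close>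
  have "mono (\<lambda>x. g (clamp x))"
  proof (rule monoI)
    fix x y :: real assume "x \<le> y"
    then have "clamp x \<le> clamp y" by (auto simp: clamp_def)
    then show "g (clamp x) \<le> g (clamp y)" using assms(1) clamp_in by (auto elim: mono_onD)
  qed
  then have "(\<lambda>x. g (clamp (f x))) \<in> borel_measurable M"
    by (rule measurable_compose[OF assms(2) borel_measurable_mono])
  then show ?thesis by (simp only: clamp_id[OF assms(3)])
qed

lemma kl_measurable:
  assumes [measurable]: "f \<in> borel_measurable M" "g \<in> borel_measurable M"
    and f: "\<And>x. f x \<in> \<Theta>" and g: "\<And>x. g x \<in> \<Theta>"
  shows "(\<lambda>x. kl (f x) (g x)) \<in> borel_measurable M"
proof -
  have [measurable]: "(\<lambda>x. C (f x)) \<in> borel_measurable M" "(\<lambda>x. C (g x)) \<in> borel_measurable M"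
    "(\<lambda>x. B (f x)) \<in> borel_measurable M" "(\<lambda>x. B (g x)) \<in> borel_measurable M"
    by (rule mono_comp_clamp_measurable[OF C_mono assms(1) f]
        mono_comp_clamp_measurable[OF C_mono assms(2) g]
        mono_comp_clamp_measurable[OF B_mono assms(1) f]
        mono_comp_clamp_measurable[OF B_mono assms(2) g])+
  show ?thesis unfolding kl_def by measurable
qed

lemma mle_measurable:
  assumes "{i\<in>{1..n}. 0 < W i} \<subseteq> J"
  shows "mle n W \<in> borel_measurable (PiM J (\<lambda>_. borel))"
proof -
  have [measurable]: "(\<lambda>Y. Y i) \<in> borel_measurable (PiM J (\<lambda>_. borel :: real measure))" if "i \<in> {i\<in>{1..n}. 0 < W i}" for i
    using that assms by (intro measurable_component_singleton) auto
  have "(\<lambda>Y. \<Sum>i\<in>{i\<in>{1..n}. 0 < W i}. W i * Y i) \<in> borel_measurable (PiM J (\<lambda>_. borel))"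
    by (intro borel_measurable_sum borel_measurable_times) auto
  then show ?thesis unfolding mle_def clamp_def by measurable
qed

lemma mle_restrict:
  assumes "{i\<in>{1..n}. 0 < W i} \<subseteq> J"
  shows "mle n W (restrict Y J) = mle n W Y"
proof -
  have "(\<Sum>i\<in>{i\<in>{1..n}. 0 < W i}. W i * restrict Y J i) = (\<Sum>i\<in>{i\<in>{1..n}. 0 < W i}. W i * Y i)"
    using assms by (intro sum.cong) auto
  then show ?thesis by (simp only: mle_def)
qed

end

section \<open>Change of measure\<close>

text \<open>It suffices to compare boxes: the indicator of a box is the product of the indicators of
  its sides, and the integral of a product over separate coordinates factorizes.\<close>

lemma PiM_density:
  assumes I: "finite I" and M: "\<And>i. prob_space (M i)"
    and f: "\<And>i. f i \<in> borel_measurable (M i)" and D: "\<And>i. prob_space (density (M i) (f i))"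
  shows "PiM I (\<lambda>i. density (M i) (f i)) = density (PiM I M) (\<lambda>x. \<Prod>i\<in>I. f i (x i))"
proof -
  interpret M: product_prob_space M I
    using M by (simp add: product_prob_space_def product_prob_space_axioms_def product_sigma_finite_def prob_space_imp_sigma_finite)
  interpret D: product_prob_space "\<lambda>i. density (M i) (f i)" I
    using D by (simp add: product_prob_space_def product_prob_space_axioms_def product_sigma_finite_def prob_space_imp_sigma_finite)
  have meas: "(\<lambda>x. \<Prod>i\<in>I. f i (x i)) \<in> borel_measurable (PiM I M)"
    using f by (intro borel_measurable_prod_ennreal measurable_compose[OF measurable_component_singleton])
  have "density (PiM I M) (\<lambda>x. \<Prod>i\<in>I. f i (x i)) = PiM I (\<lambda>i. density (M i) (f i))"
  proof (rule D.PiM_eqI[OF I])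
    show "sets (density (PiM I M) (\<lambda>x. \<Prod>i\<in>I. f i (x i))) = sets (PiM I (\<lambda>i. density (M i) (f i)))"
      by (simp cong: sets_PiM_cong)
    fix A assume "\<And>i. i \<in> I \<Longrightarrow> A i \<in> sets (density (M i) (f i))"
    then have A: "\<And>i. i \<in> I \<Longrightarrow> A i \<in> sets (M i)" by simp
    have "emeasure (density (PiM I M) (\<lambda>x. \<Prod>i\<in>I. f i (x i))) (Pi\<^sub>E I A)
        = (\<integral>\<^sup>+x. (\<Prod>i\<in>I. f i (x i)) * indicator (Pi\<^sub>E I A) x \<partial>PiM I M)"
      using A I by (intro emeasure_density meas sets_PiM_I_finite)
    also have "\<dots> = (\<integral>\<^sup>+x. (\<Prod>i\<in>I. f i (x i) * indicator (A i) (x i)) \<partial>PiM I M)"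
    proof (rule nn_integral_cong)
      fix x assume x: "x \<in> space (PiM I M)"
      have "indicator (Pi\<^sub>E I A) x = (\<Prod>i\<in>I. indicator (A i) (x i) :: ennreal)"
      proof (cases "x \<in> Pi\<^sub>E I A")
        case True
        then show ?thesis by (auto simp: PiE_mem)
      next
        case False
        then obtain i where "i \<in> I" "x i \<notin> A i" using x by (auto simp: space_PiM PiE_iff)
        then have "(\<Prod>i\<in>I. indicator (A i) (x i) :: ennreal) = 0"
          using I by (intro prod_zero bexI[of _ i]) auto
        then show ?thesis using False by simp
      qed
      then show "(\<Prod>i\<in>I. f i (x i)) * indicator (Pi\<^sub>E I A) x = (\<Prod>i\<in>I. f i (x i) * indicator (A i) (x i))"
        by (simp add: prod.distrib)
    qed
    also have "\<dots> = (\<Prod>i\<in>I. \<integral>\<^sup>+x. f i x * indicator (A i) x \<partial>M i)"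
      using A f I by (intro M.product_nn_integral_prod) auto
    also have "\<dots> = (\<Prod>i\<in>I. emeasure (density (M i) (f i)) (A i))"
      using A f by (intro prod.cong refl) (simp add: emeasure_density)
    finally show "emeasure (density (PiM I M) (\<lambda>x. \<Prod>i\<in>I. f i (x i))) (Pi\<^sub>E I A)
       = (\<Prod>i\<in>I. emeasure (density (M i) (f i)) (A i))" .
  qed
  then show ?thesis by simp
qed

section \<open>Joint laws and the second moment of the likelihood ratio\<close>

context natural_exp_family
begin

lemma joint_law_product_prob:
  assumes "\<And>i. g i \<in> \<Theta>" shows "product_prob_space (\<lambda>i. law P q (g i))"
  using law_prob[OF assms]
  by (simp add: product_prob_space_def product_prob_space_axioms_def product_sigma_finite_def prob_space_imp_sigma_finite)

lemma sets_PiM_law: "sets (PiM J (\<lambda>i. law P q (g i))) = sets (PiM J (\<lambda>_. borel))"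
  by (rule sets_PiM_cong) (simp_all add: sets_law)

lemma measurable_PiM_law: "measurable (PiM J (\<lambda>i. law P q (g i))) N = measurable (PiM J (\<lambda>_. borel)) N"
  by (rule measurable_cong_sets) (simp_all add: sets_PiM_law)

text \<open>Restriction to \<open>J\<close> maps the full product law to the product law over
  \<open>J\<close>, and \<open>H\<close> does not see the other coordinates.\<close>

lemma nn_integral_joint_law_restrict:
  assumes g: "\<And>i. g i \<in> \<Theta>" and J: "J \<subseteq> {1..n}"
    and H: "H \<in> borel_measurable (PiM J (\<lambda>_. borel))"
    and HJ: "\<And>Y. H (restrict Y J) = H Y"
  shows "(\<integral>\<^sup>+Y. H Y \<partial>joint_law P q n g) = (\<integral>\<^sup>+Y. H Y \<partial>PiM J (\<lambda>i. law P q (g i)))"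
proof -
  interpret product_prob_space "\<lambda>i. law P q (g i)" by (rule joint_law_product_prob[OF g])
  let ?M = "\<lambda>I. PiM I (\<lambda>i. law P q (g i))"
  have "(\<integral>\<^sup>+Y. H Y \<partial>?M J) = (\<integral>\<^sup>+Y. H Y \<partial>distr (?M {1..n}) (?M J) (\<lambda>Y. restrict Y J))"
    by (simp only: distr_restrict[OF J finite_atLeastAtMost, symmetric])
  also have "\<dots> = (\<integral>\<^sup>+Y. H (restrict Y J) \<partial>?M {1..n})"
  proof (rule nn_integral_distr)
    show "(\<lambda>Y. restrict Y J) \<in> measurable (?M {1..n}) (?M J)" by (rule measurable_restrict_subset[OF J])
    show "H \<in> borel_measurable (distr (?M {1..n}) (?M J) (\<lambda>Y. restrict Y J))"
      using H by (simp add: measurable_PiM_law)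
  qed
  finally show ?thesis by (simp only: HJ joint_law_def)
qed

text \<open>Relates \<open>lr\<close> to the quotient in \<open>delta\<close>; the integrands can
  differ only at zeros of \<open>p\<close>, where the quotient is \<open>0 / 0\<close>.\<close>

lemma second_moment_lr:
  assumes t: "t \<in> \<Theta>" and s: "s \<in> \<Theta>"
  shows "(\<integral>\<^sup>+y. (ennreal (lr t s y))\<^sup>2 \<partial>law P q t) = (\<integral>\<^sup>+y. ennreal ((q y s)\<^sup>2 / (q y t)\<^sup>2) \<partial>law P q t)"
proof (rule nn_integral_cong_AE)
  show "AE y in law P q t. (ennreal (lr t s y))\<^sup>2 = ennreal ((q y s)\<^sup>2 / (q y t)\<^sup>2)"
    using AE_law_pos[OF t]
  proof eventually_elim
    case (elim y)
    then have "q y t \<noteq> 0" by (simp add: q_eq[OF t])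
    then show ?case
      using lr_pos[of t s y] by (simp add: q_lr[OF t s] power_mult_distrib ennreal_power)
  qed
qed

text \<open>Only the coordinates in \<open>J\<close> enter the likelihood ratio, which is what makes the
  bias of a localizing scheme a sum over its support.\<close>

lemma change_of_measure:
  assumes g: "\<And>i. g i \<in> \<Theta>" and t: "t \<in> \<Theta>" and J: "J \<subseteq> {1..n}"
    and H: "H \<in> borel_measurable (PiM J (\<lambda>_. borel))"
    and HJ: "\<And>Y. H (restrict Y J) = H Y"
  shows "(\<integral>\<^sup>+Y. H Y \<partial>joint_law P q n g)\<^sup>2 \<le> (\<integral>\<^sup>+Y. (H Y)\<^sup>2 \<partial>joint_law P q n (\<lambda>_. t)) *
    (\<Prod>i\<in>J. \<integral>\<^sup>+y. ennreal ((q y (g i))\<^sup>2 / (q y t)\<^sup>2) \<partial>law P q t)"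
proof -
  interpret T: product_prob_space "\<lambda>_. law P q t" by (rule joint_law_product_prob[OF t])
  have fin: "finite J" using J by (rule finite_subset) simp
  let ?Q = "PiM J (\<lambda>_. law P q t)"
  let ?L = "\<lambda>Y. \<Prod>i\<in>J. ennreal (lr t (g i) (Y i))"
  have H2: "(\<lambda>Y. (H Y)\<^sup>2) \<in> borel_measurable (PiM J (\<lambda>_. borel))"
    using H by measurable
  have H': "H \<in> borel_measurable ?Q" using H by (simp add: measurable_PiM_law[of _ "\<lambda>_. t"])
  have lrm: "(\<lambda>y. ennreal (lr t (g i) y)) \<in> borel_measurable (law P q t)" for i
    using lr_measurable by (simp add: measurable_law)
  have Lm: "?L \<in> borel_measurable ?Q"
    by (intro borel_measurable_prod_ennreal measurable_compose[OF _ lrm] measurable_component_singleton)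
  have dens: "PiM J (\<lambda>i. law P q (g i)) = density ?Q ?L"
    unfolding law_change[OF t g] using law_prob[OF g] law_prob[OF t]
    by (intro PiM_density fin lrm) (auto simp: law_change[OF t g, symmetric])
  have "(\<integral>\<^sup>+Y. H Y \<partial>joint_law P q n g) = (\<integral>\<^sup>+Y. H Y \<partial>PiM J (\<lambda>i. law P q (g i)))"
    by (rule nn_integral_joint_law_restrict[OF g J H HJ])
  also have "\<dots> = (\<integral>\<^sup>+Y. H Y * ?L Y \<partial>?Q)"
    unfolding dens using H' Lm by (subst nn_integral_density) (auto simp: mult.commute)
  finally have "(\<integral>\<^sup>+Y. H Y \<partial>joint_law P q n g)\<^sup>2 = (\<integral>\<^sup>+Y. H Y * ?L Y \<partial>?Q)\<^sup>2" by simp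
  also have "\<dots> \<le> (\<integral>\<^sup>+Y. (H Y)\<^sup>2 \<partial>?Q) * (\<integral>\<^sup>+Y. (?L Y)\<^sup>2 \<partial>?Q)"
    by (rule Cauchy_Schwarz_nn_integral[OF H' Lm])
  also have "(\<integral>\<^sup>+Y. (H Y)\<^sup>2 \<partial>?Q) = (\<integral>\<^sup>+Y. (H Y)\<^sup>2 \<partial>joint_law P q n (\<lambda>_. t))"
    by (rule nn_integral_joint_law_restrict[OF t J H2, symmetric]) (simp only: HJ)
  also have "(\<integral>\<^sup>+Y. (?L Y)\<^sup>2 \<partial>?Q) = (\<integral>\<^sup>+Y. (\<Prod>i\<in>J. (ennreal (lr t (g i) (Y i)))\<^sup>2) \<partial>?Q)"
    by (simp add: prod_power_distrib)
  also have "\<dots> = (\<Prod>i\<in>J. \<integral>\<^sup>+y. (ennreal (lr t (g i) y))\<^sup>2 \<partial>law P q t)"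
    by (rule T.product_nn_integral_prod[OF fin]) (use lrm in measurable)
  finally show ?thesis by (simp only: second_moment_lr[OF t g])
qed

lemma AE_joint_law_pos:
  assumes "\<And>i. g i \<in> \<Theta>"
  shows "AE Y in joint_law P q n g. \<forall>i\<in>{1..n}. 0 < p (Y i)"
proof (rule AE_finite_allI[OF finite_atLeastAtMost])
  fix i assume "i \<in> {1..n}"
  then show "AE Y in joint_law P q n g. 0 < p (Y i)"
    unfolding joint_law_def by (rule AE_PiM_component[OF law_prob[OF assms] _ AE_law_pos[OF assms]])
qed

end

text \<open>For a positive finite moment this is an equality; at a zero moment the default
  \<open>ln 0 = 0\<close> still gives the inequality.\<close>

lemma second_moment_le_exp_delta:
  assumes "delta P q t s \<noteq> \<infinity>"
  shows "(\<integral>\<^sup>+y. ennreal ((q y s)\<^sup>2 / (q y t)\<^sup>2) \<partial>law P q t) \<le> ennreal (exp (real_of_ereal (delta P q t s)))"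
proof -
  define m where "m = (\<integral>\<^sup>+y. ennreal ((q y s)\<^sup>2 / (q y t)\<^sup>2) \<partial>law P q t)"
  have m: "m \<noteq> \<infinity>" and d: "delta P q t s = ereal (ln (enn2real m))"
    using assms by (auto simp: delta_def m_def[symmetric] Let_def split: if_splits)
  have "enn2real m \<le> exp (ln (enn2real m))"
    by (cases "enn2real m = 0") (auto simp: less_le)
  then have "ennreal (enn2real m) \<le> ennreal (exp (ln (enn2real m)))"
    by (rule ennreal_leI)
  then show ?thesis
    using m by (simp add: d m_def[symmetric] ennreal_enn2real_if)
qed

text \<open>No summand is \<open>-\<infinity>\<close>, so a finite upper bound on the sum makes
  every \<open>delta\<close> finite, and the exponential turns the sum into the product.\<close>

lemma prod_second_moment_le:
  assumes le: "modeling_bias P q n g W t \<le> ereal \<Delta>"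
  shows "(\<Prod>i\<in>{i\<in>{1..n}. 0 < W i}. \<integral>\<^sup>+y. ennreal ((q y (g i))\<^sup>2 / (q y t)\<^sup>2) \<partial>law P q t) \<le> ennreal (exp \<Delta>)"
proof -
  let ?J = "{i\<in>{1..n}. 0 < W i}"
  have nminf: "delta P q t s \<noteq> -\<infinity>" for s by (simp add: delta_def Let_def)
  have "(\<Sum>i\<in>?J. delta P q t (g i)) \<noteq> \<infinity>"
    using le by (auto simp: modeling_bias_def)
  then have fin: "delta P q t (g i) \<noteq> \<infinity>" if "i \<in> ?J" for i
    using that nminf by (auto simp: sum_Pinfty)
  have "ereal (\<Sum>i\<in>?J. real_of_ereal (delta P q t (g i))) = (\<Sum>i\<in>?J. delta P q t (g i))"
    unfolding sum_ereal[symmetric] using fin nminf by (intro sum.cong refl ereal_real') auto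
  then have S: "(\<Sum>i\<in>?J. real_of_ereal (delta P q t (g i))) \<le> \<Delta>"
    using le by (metis ereal_less_eq(3) modeling_bias_def)
  have "(\<Prod>i\<in>?J. \<integral>\<^sup>+y. ennreal ((q y (g i))\<^sup>2 / (q y t)\<^sup>2) \<partial>law P q t)
      \<le> (\<Prod>i\<in>?J. ennreal (exp (real_of_ereal (delta P q t (g i)))))"
    by (intro prod_mono_ennreal second_moment_le_exp_delta fin)
  also have "\<dots> = ennreal (exp (\<Sum>i\<in>?J. real_of_ereal (delta P q t (g i))))"
    by (simp add: prod_ennreal exp_sum)
  also have "\<dots> \<le> ennreal (exp \<Delta>)" using S by (intro ennreal_leI) simp
  finally show ?thesis .
qed

section \<open>Aggregation\<close>

text \<open>For \<open>r \<le> 1\<close> this is subadditivity, as \<open>x powr (r - 1)\<close>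
  decreases; for \<open>r \<ge> 1\<close> it is convexity at the midpoint.\<close>

lemma powr_add_le:
  fixes a b r :: real
  assumes "0 \<le> a" "0 \<le> b" "0 < r"
  shows "(a + b) powr r \<le> 2 powr max (r - 1) 0 * (a powr r + b powr r)"
proof -
  consider "a = 0 \<or> b = 0" | "0 < a" "0 < b" "r \<le> 1" | "0 < a" "0 < b" "1 \<le> r"
    using assms by fastforce
  then show ?thesis
  proof cases
    case 1
    have "(1::real) \<le> 2 powr max (r - 1) 0" by (rule ge_one_powr_ge_zero) auto
    then have "1 * (a powr r + b powr r) \<le> 2 powr max (r - 1) 0 * (a powr r + b powr r)"
      by (rule mult_right_mono) auto
    with 1 show ?thesis by auto
  next
    case 2
    have "(a + b) powr r = (a + b) powr (r - 1) * (a + b)"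
      using 2 powr_mult_base[of "a + b" "r - 1"] by (simp add: mult.commute)
    also have "\<dots> = (a + b) powr (r - 1) * a + (a + b) powr (r - 1) * b"
      by (simp add: algebra_simps)
    also have "\<dots> \<le> a powr (r - 1) * a + b powr (r - 1) * b"
      using 2 by (intro add_mono mult_right_mono powr_mono2') auto
    also have "\<dots> = a powr r + b powr r"
      using 2 powr_mult_base[of a "r - 1"] powr_mult_base[of b "r - 1"] by (simp add: mult.commute)
    finally show ?thesis using 2 by (simp add: max_def)
  next
    case 3
    have "(a / 2 + b / 2) powr r \<le> a powr r / 2 + b powr r / 2"
      using convex_onD[OF powr_convex[OF 3(3)], of "1/2" a b] 3 by (simp add: algebra_simps)
    then have "(2 * (a / 2 + b / 2)) powr r \<le> 2 powr r * (a powr r / 2 + b powr r / 2)"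
      using 3 by (subst powr_mult) (auto intro!: mult_left_mono)
    also have "\<dots> = 2 powr (r - 1) * (a powr r + b powr r)"
      by (simp add: powr_diff algebra_simps)
    finally show ?thesis using 3 by (simp add: max_def algebra_simps)
  qed
qed

locale aggregation = regular_exp_family +
  fixes n K :: nat and w :: "nat \<Rightarrow> nat \<Rightarrow> real" and u0 u :: real
    and Kag :: "real \<Rightarrow> real" and b :: real and z :: "nat \<Rightarrow> real"
  assumes schemes: "localizing_schemes n K w" and A3: "cond_A3 n K w u0 u"
    and kernel: "agg_kernel Kag b" and z_pos: "k \<in> {1..K} \<Longrightarrow> 0 < z k"
begin

abbreviation N :: "nat \<Rightarrow> real" where
  "N k \<equiv> weight_sum n (w k)"

abbreviation weak :: "nat \<Rightarrow> (nat \<Rightarrow> real) \<Rightarrow> real" where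
  "weak k \<equiv> mle n (w k)"

abbreviation supp :: "nat \<Rightarrow> nat set" where
  "supp k \<equiv> {i\<in>{1..n}. 0 < w k i}"

lemma N_pos: "k \<in> {1..K} \<Longrightarrow> 0 < N k"
  using schemes by (simp add: localizing_schemes_def)

lemma w_nonneg: "k \<in> {1..K} \<Longrightarrow> i \<in> {1..n} \<Longrightarrow> 0 \<le> w k i"
  using schemes by (simp add: localizing_schemes_def)

lemma w_mono: "k' \<in> {1..K} \<Longrightarrow> k \<in> {1..K} \<Longrightarrow> k' \<le> k \<Longrightarrow> i \<in> {1..n} \<Longrightarrow> w k' i \<le> w k i"
  using A3 by (cases "k' = k") (auto simp: cond_A3_def)

lemma supp_mono: "k' \<in> {1..K} \<Longrightarrow> k \<in> {1..K} \<Longrightarrow> k' \<le> k \<Longrightarrow> supp k' \<subseteq> supp k"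
  using w_mono by (fastforce intro: less_le_trans)

lemma u_bounds: "0 < u" "u < 1"
  using A3 by (auto simp: cond_A3_def)

lemma N_Suc_le:
  assumes "1 \<le> k" "Suc k \<le> K" shows "N k \<le> u * N (Suc k)"
proof -
  have "Suc k \<in> {2..K}" using assms by simp
  then have "N (Suc k - 1) / N (Suc k) \<le> u" using A3 unfolding cond_A3_def by blast
  then show ?thesis using N_pos[of "Suc k"] assms by (simp add: field_simps)
qed

lemma Kag_bounds: "0 \<le> t \<Longrightarrow> 0 \<le> Kag t" "0 \<le> t \<Longrightarrow> Kag t \<le> 1" "1 < t \<Longrightarrow> Kag t = 0"
  using kernel by (auto simp: agg_kernel_def)

text \<open>The version of \<open>agg_est\<close> in which the weak estimates and the divergence are given by their
  closed forms, so that measurability and the dependence on the data are explicit.\<close>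

primrec agg :: "nat \<Rightarrow> (nat \<Rightarrow> real) \<Rightarrow> real" where
  "agg 0 Y = weak 1 Y"
| "agg (Suc k) Y =
     (if k = 0 then weak 1 Y
      else Kag (N (Suc k) * kl (weak (Suc k) Y) (agg k Y) / z (Suc k)) * weak (Suc k) Y
         + (1 - Kag (N (Suc k) * kl (weak (Suc k) Y) (agg k Y) / z (Suc k))) * agg k Y)"

lemma scaled_kl_nonneg:
  "k \<in> {1..K} \<Longrightarrow> t \<in> \<Theta> \<Longrightarrow> s \<in> \<Theta> \<Longrightarrow> 0 \<le> N k * kl t s / z k"
  using N_pos z_pos kl_nonneg by (simp add: less_imp_le)

section \<open>Range, measurability and data dependence of the aggregated estimate\<close>

lemma agg_in: "k \<le> K \<Longrightarrow> agg k Y \<in> \<Theta>"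
proof (induction k)
  case (Suc k)
  then show ?case
    using Kag_bounds scaled_kl_nonneg[of "Suc k"] mle_in by (simp add: \<Theta>_convex)
qed (simp add: mle_in)

text \<open>The kernel is monotone on the half-line only; \<open>max 0\<close> extends it to the
  line, and the sign makes it increasing and hence Borel.\<close>

lemma Kag_measurable:
  assumes [measurable]: "f \<in> borel_measurable M" and "\<And>x. 0 \<le> f x"
  shows "(\<lambda>x. Kag (f x)) \<in> borel_measurable M"
proof -
  have "mono (\<lambda>t. - Kag (max 0 t))"
  proof (rule monoI)
    fix x y :: real assume "x \<le> y"
    then have "max 0 x \<le> max 0 y" by simp
    moreover have "antimono_on {0..} Kag" using kernel by (simp add: agg_kernel_def)
    ultimately have "Kag (max 0 y) \<le> Kag (max 0 x)" by (metis monotone_onD atLeast_iff max.cobounded1)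
    then show "- Kag (max 0 x) \<le> - Kag (max 0 y)" by simp
  qed
  then have [measurable]: "(\<lambda>t. - Kag (max 0 t)) \<in> borel_measurable borel"
    by (rule borel_measurable_mono)
  have "(\<lambda>x. - (- Kag (max 0 (f x)))) \<in> borel_measurable M" by measurable
  then show ?thesis using assms(2) by (simp add: max_absorb2)
qed

text \<open>The index set \<open>J\<close> is left free because the estimate is viewed both on the
  full sample and on the support of a single scale.\<close>

lemma agg_measurable:
  assumes J: "\<And>k. k \<in> {1..k0} \<Longrightarrow> supp k \<subseteq> J" and k0: "k0 \<le> K"
  shows "k \<in> {1..k0} \<Longrightarrow> agg k \<in> borel_measurable (PiM J (\<lambda>_. borel))"
proof (induction k)
  case (Suc k)
  have weak: "weak (Suc k) \<in> borel_measurable (PiM J (\<lambda>_. borel))"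
    using Suc.prems J by (intro mle_measurable)
  show ?case
  proof (cases "k = 0")
    case True
    then have "agg (Suc k) = weak (Suc k)" by (simp add: fun_eq_iff)
    then show ?thesis using weak by (simp only:)
  next
    case False
    let ?c = "\<lambda>Y. N (Suc k) * kl (weak (Suc k) Y) (agg k Y) / z (Suc k)"
    have agg: "agg k \<in> borel_measurable (PiM J (\<lambda>_. borel))"
      using False Suc by simp
    have k: "Suc k \<in> {1..K}" "k \<le> K" using Suc.prems k0 by auto
    have "?c \<in> borel_measurable (PiM J (\<lambda>_. borel))"
      by (intro borel_measurable_divide borel_measurable_times borel_measurable_const
          kl_measurable weak agg mle_in agg_in k)
    then have Kag: "(\<lambda>Y. Kag (?c Y)) \<in> borel_measurable (PiM J (\<lambda>_. borel))"
      by (rule Kag_measurable) (rule scaled_kl_nonneg[OF k(1) mle_in agg_in[OF k(2)]])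
    have "agg (Suc k) = (\<lambda>Y. Kag (?c Y) * weak (Suc k) Y + (1 - Kag (?c Y)) * agg k Y)"
      using False by (simp add: fun_eq_iff)
    then show ?thesis
      by (simp only:) (intro borel_measurable_add borel_measurable_times borel_measurable_diff
          borel_measurable_const Kag weak agg)
  qed
qed simp

lemma agg_restrict:
  assumes J: "\<And>k. k \<in> {1..k0} \<Longrightarrow> supp k \<subseteq> J"
  shows "k \<in> {1..k0} \<Longrightarrow> agg k (restrict Y J) = agg k Y"
proof -
  define Y' where "Y' = restrict Y J"
  have weak: "weak k Y' = weak k Y" if "k \<in> {1..k0}" for k
    unfolding Y'_def by (rule mle_restrict[OF J[OF that]])
  have "k \<in> {1..k0} \<Longrightarrow> agg k Y' = agg k Y"
  proof (induction k)
    case (Suc k)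
    then show ?case using weak[OF Suc.prems] by (cases "k = 0") auto
  qed simp
  then show "k \<in> {1..k0} \<Longrightarrow> agg k (restrict Y J) = agg k Y" by (simp only: Y'_def)
qed

lemma agg_est_eq:
  assumes pos: "\<forall>i\<in>{1..n}. 0 < p (Y i)"
  shows "k \<in> {1..K} \<Longrightarrow> agg_est P q \<Theta> n w Kag z k Y = agg k Y"
proof (induction k)
  case (Suc k)
  have w: "local_mle q \<Theta> n (w k') Y = weak k' Y" if "k' \<in> {1..K}" for k'
    using pos that w_nonneg N_pos by (intro local_mle_eq) auto
  show ?case
  proof (cases "k = 0")
    case True
    then show ?thesis using Suc.prems w[of 1] by simp
  next
    case False
    then have "agg_est P q \<Theta> n w Kag z k Y = agg k Y" using Suc by simp
    moreover have "KL P q (weak (Suc k) Y) (agg k Y) = kl (weak (Suc k) Y) (agg k Y)"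
      using Suc.prems by (intro KL_eq_kl mle_in agg_in) simp
    ultimately show ?thesis
      using False w[OF Suc.prems] by (simp add: Let_def)
  qed
qed simp

lemma scaled_KL_eq:
  assumes "\<forall>i\<in>{1..n}. 0 < p (Y i)" and "k \<in> {1..K}" "l \<in> {1..K}"
  shows "N k * KL P q (local_mle q \<Theta> n (w k) Y) (agg_est P q \<Theta> n w Kag z l Y)
    = N k * kl (weak k Y) (agg l Y)"
proof -
  have "local_mle q \<Theta> n (w k) Y = weak k Y"
    using assms w_nonneg N_pos by (intro local_mle_eq) auto
  then show ?thesis
    using assms by (simp add: agg_est_eq KL_eq_kl mle_in agg_in)
qed

section \<open>Stability of the aggregated estimate along the scales\<close>

lemma kl_agg_Suc:
  assumes "1 \<le> k" "Suc k \<le> K"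
  shows "N (Suc k) * kl (agg (Suc k) Y) (agg k Y) \<le> z (Suc k)"
proof -
  define v where "v = N (Suc k) * kl (weak (Suc k) Y) (agg k Y)"
  define \<gamma> where "\<gamma> = Kag (v / z (Suc k))"
  have agg: "agg (Suc k) Y = \<gamma> * weak (Suc k) Y + (1 - \<gamma>) * agg k Y"
    using assms by (simp add: \<gamma>_def v_def)
  have in\<Theta>: "agg k Y \<in> \<Theta>" using assms by (intro agg_in) simp
  have k: "Suc k \<in> {1..K}" using assms by simp
  \<comment> \<open>Either the test statistic is at most \<open>z (Suc k)\<close>, and
    \<open>kl_contract\<close> bounds the step by it, or the kernel vanishes and the estimate
    stays.\<close>
  show ?thesis
  proof (cases "v \<le> z (Suc k)")
    case True
    have "0 \<le> v / z (Suc k)" unfolding v_def using scaled_kl_nonneg[OF k mle_in in\<Theta>] by simp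
    then have "kl (agg (Suc k) Y) (agg k Y) \<le> kl (weak (Suc k) Y) (agg k Y)"
      unfolding agg \<gamma>_def by (intro kl_contract mle_in in\<Theta> Kag_bounds)
    then have "N (Suc k) * kl (agg (Suc k) Y) (agg k Y) \<le> v"
      unfolding v_def using N_pos[OF k] by (intro mult_left_mono) auto
    then show ?thesis using True by simp
  next
    case False
    then have "\<gamma> = 0" unfolding \<gamma>_def using z_pos[OF k] by (intro Kag_bounds) simp
    then show ?thesis using z_pos[OF k] by (simp only: agg) (simp add: kl_self)
  qed
qed

text \<open>In terms of distances the steps add up by the ordinary triangle inequality, with no
  factor \<kappa> per step.\<close>

lemma dist_agg_Suc:
  assumes "1 \<le> k" "Suc k \<le> K"
  shows "sqrt (N (Suc k) * m) * \<bar>agg (Suc k) Y - agg k Y\<bar> \<le> sqrt (z (Suc k))"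
proof -
  have "N (Suc k) * (m * (agg (Suc k) Y - agg k Y)\<^sup>2) \<le> N (Suc k) * kl (agg (Suc k) Y) (agg k Y)"
    using N_pos[of "Suc k"] assms by (intro mult_left_mono kl_lower agg_in) auto
  also have "\<dots> \<le> z (Suc k)" by (rule kl_agg_Suc[OF assms])
  finally have "sqrt (N (Suc k) * m * (agg (Suc k) Y - agg k Y)\<^sup>2) \<le> sqrt (z (Suc k))"
    by (simp add: mult.assoc)
  then show ?thesis by (simp only: real_sqrt_mult real_sqrt_abs)
qed

lemma N_le_power: "1 \<le> k \<Longrightarrow> k + j \<le> K \<Longrightarrow> N k \<le> u ^ j * N (k + j)"
proof (induction j)
  case (Suc j)
  then have "N k \<le> u ^ j * N (k + j)" by simp
  also have "\<dots> \<le> u ^ j * (u * N (Suc (k + j)))"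
    using Suc.prems u_bounds by (intro mult_left_mono N_Suc_le) auto
  finally show ?case by (simp add: mult_ac)
qed simp

lemma c_u_eq: "c_u u = sqrt u / (1 - sqrt u)"
proof -
  have s: "0 < sqrt u" "sqrt u < 1" using u_bounds by simp_all
  have "u powr (- 1 / 2) = inverse (sqrt u)"
    using u_bounds by (simp add: powr_minus powr_half_sqrt)
  then show ?thesis using s by (simp add: c_u_def field_simps)
qed

lemma c_u_nonneg: "0 \<le> c_u u"
  unfolding c_u_eq using u_bounds by simp

lemma z_le_zbar: "l \<in> {k..K} \<Longrightarrow> z l \<le> zbar K z k"
  unfolding zbar_def by (intro Max_ge) auto

text \<open>Telescoping over the scales; the increments form a geometric series with ratio
  \<open>sqrt u\<close>, whose sum is \<open>c_u u\<close>.\<close>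

lemma dist_agg:
  assumes k: "1 \<le> k"
  shows "k + j \<le> K \<Longrightarrow> sqrt (N k * m) * \<bar>agg k Y - agg (k + j) Y\<bar>
    \<le> sqrt (zbar K z k) * (c_u u * (1 - sqrt u ^ j))"
proof (induction j)
  case (Suc j)
  have s: "0 < sqrt u" "sqrt u < 1" using u_bounds by simp_all
  \<comment> \<open>The step is measured at the scale it leads to; comparing \<open>N k\<close> with
    \<open>N (k + Suc j)\<close> gains the factor \<open>sqrt u ^ Suc j\<close>.\<close>
  have "sqrt (N k * m) * \<bar>agg (k + j) Y - agg (k + Suc j) Y\<bar>
      \<le> sqrt (u ^ Suc j * (N (k + Suc j) * m)) * \<bar>agg (k + j) Y - agg (k + Suc j) Y\<bar>"
    using N_le_power[OF k Suc.prems] m_pos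
    by (intro mult_right_mono) (auto simp: mult.assoc[symmetric])
  also have "\<dots> = sqrt u ^ Suc j * (sqrt (N (Suc (k + j)) * m) * \<bar>agg (Suc (k + j)) Y - agg (k + j) Y\<bar>)"
    by (simp add: real_sqrt_mult real_sqrt_power abs_minus_commute)
  also have "\<dots> \<le> sqrt u ^ Suc j * sqrt (z (Suc (k + j)))"
    using s k Suc.prems by (intro mult_left_mono dist_agg_Suc) auto
  also have "\<dots> \<le> sqrt u ^ Suc j * sqrt (zbar K z k)"
    using s Suc.prems by (intro mult_left_mono) (auto intro!: z_le_zbar)
  finally have step: "sqrt (N k * m) * \<bar>agg (k + j) Y - agg (k + Suc j) Y\<bar>
      \<le> sqrt (zbar K z k) * sqrt u ^ Suc j" by (simp add: mult_ac)
  have "sqrt (N k * m) * \<bar>agg k Y - agg (k + Suc j) Y\<bar>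
      \<le> sqrt (N k * m) * (\<bar>agg k Y - agg (k + j) Y\<bar> + \<bar>agg (k + j) Y - agg (k + Suc j) Y\<bar>)"
    using N_pos[of k] m_pos k Suc.prems by (intro mult_left_mono) auto
  also have "\<dots> \<le> sqrt (zbar K z k) * (c_u u * (1 - sqrt u ^ j)) + sqrt (zbar K z k) * sqrt u ^ Suc j"
    unfolding distrib_left using Suc step by (intro add_mono) auto
  \<comment> \<open>Exact, because \<open>c_u u * (1 - sqrt u) = sqrt u\<close>.\<close>
  also have "\<dots> = sqrt (zbar K z k) * (c_u u * (1 - sqrt u ^ Suc j))"
    unfolding distrib_left[symmetric] c_u_eq using s by (simp add: field_simps)
  finally show ?case .
qed simp

text \<open>The left side passes to distances once, by \<open>kl_upper\<close>, and
  \<open>kl_lower\<close> leads back. So \<kappa> enters to the first power, however many scales lie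
  between \<open>k\<close> and \<open>K\<close>.\<close>

lemma sqrt_kl_oracle:
  assumes k: "k \<in> {1..K}"
  shows "sqrt (N k * kl (weak k Y) (agg K Y))
    \<le> \<kappa> * (sqrt (N k * kl (weak k Y) (agg k Y)) + c_u u * sqrt (zbar K z k))"
proof -
  have N: "0 < N k" by (rule N_pos[OF k])
  have aggk: "agg k Y \<in> \<Theta>" and aggK: "agg K Y \<in> \<Theta>" using k by (auto intro: agg_in)
  have s: "0 < sqrt u" using u_bounds by simp
  have zb: "0 \<le> sqrt (zbar K z k)" using z_pos[OF k] z_le_zbar[of k k] k by auto
  have "sqrt (N k * kl (weak k Y) (agg K Y)) \<le> sqrt (N k * (\<kappa>\<^sup>2 * m * (weak k Y - agg K Y)\<^sup>2))"
    using N by (intro real_sqrt_le_mono mult_left_mono kl_upper mle_in aggK) auto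
  also have "\<dots> = \<kappa> * (sqrt (N k * m) * \<bar>weak k Y - agg K Y\<bar>)"
    using \<kappa>_ge_1 by (simp add: real_sqrt_mult)
  also have "\<dots> \<le> \<kappa> * (sqrt (N k * m) * (\<bar>weak k Y - agg k Y\<bar> + \<bar>agg k Y - agg K Y\<bar>))"
    using \<kappa>_ge_1 N m_pos by (intro mult_left_mono) auto
  also have "\<dots> \<le> \<kappa> * (sqrt (N k * kl (weak k Y) (agg k Y)) + c_u u * sqrt (zbar K z k))"
    unfolding distrib_left[of "sqrt (N k * m)"]
  proof (intro mult_left_mono add_mono)
    have "sqrt (N k * m) * \<bar>weak k Y - agg k Y\<bar> = sqrt (N k * (m * (weak k Y - agg k Y)\<^sup>2))"
      by (simp add: real_sqrt_mult)
    also have "\<dots> \<le> sqrt (N k * kl (weak k Y) (agg k Y))"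
      using N by (intro real_sqrt_le_mono mult_left_mono kl_lower mle_in aggk) auto
    finally show "sqrt (N k * m) * \<bar>weak k Y - agg k Y\<bar> \<le> sqrt (N k * kl (weak k Y) (agg k Y))" .
    have "sqrt (N k * m) * \<bar>agg k Y - agg K Y\<bar> \<le> sqrt (zbar K z k) * (c_u u * (1 - sqrt u ^ (K - k)))"
      using dist_agg[of k "K - k" Y] k by simp
    also have "\<dots> \<le> sqrt (zbar K z k) * (c_u u * 1)"
      using zb c_u_nonneg s by (intro mult_left_mono) auto
    finally show "sqrt (N k * m) * \<bar>agg k Y - agg K Y\<bar> \<le> c_u u * sqrt (zbar K z k)"
      by (simp add: mult.commute)
  qed (use \<kappa>_ge_1 in auto)
  finally show ?thesis .
qed

lemma powr_kl_oracle:
  assumes k: "k \<in> {1..K}" and r: "0 < r"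
  shows "\<bar>N k * kl (weak k Y) (agg K Y)\<bar> powr (r / 2)
    \<le> 2 powr max (r - 1) 0 * \<kappa> powr r *
      (\<bar>N k * kl (weak k Y) (agg k Y)\<bar> powr (r / 2) + ((c_u u)\<^sup>2 * zbar K z k) powr (r / 2))"
proof -
  have half: "x powr (r / 2) = sqrt x powr r" if "0 \<le> x" for x
    using that by (simp add: powr_half_sqrt[symmetric] powr_powr)
  have nonneg: "0 \<le> N k * kl (weak k Y) (agg l Y)" if "l \<le> K" for l
    using N_pos[OF k] kl_nonneg[OF mle_in agg_in[OF that]] by simp
  have zb: "0 \<le> zbar K z k" using z_pos[OF k] z_le_zbar[of k k] k by auto
  let ?a = "sqrt (N k * kl (weak k Y) (agg k Y))" and ?b = "c_u u * sqrt (zbar K z k)"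
  have a0: "0 \<le> ?a" and b0: "0 \<le> ?b" using nonneg[of k] k zb c_u_nonneg by auto
  have "\<bar>N k * kl (weak k Y) (agg K Y)\<bar> powr (r / 2) = sqrt (N k * kl (weak k Y) (agg K Y)) powr r"
    using nonneg[of K] half by simp
  also have "\<dots> \<le> (\<kappa> * (?a + ?b)) powr r"
    using r nonneg[of K] by (intro powr_mono2 sqrt_kl_oracle k) auto
  also have "\<dots> = \<kappa> powr r * (?a + ?b) powr r"
    by (rule powr_mult)
  also have "\<dots> \<le> \<kappa> powr r * (2 powr max (r - 1) 0 * (?a powr r + ?b powr r))"
    by (intro mult_left_mono powr_add_le a0 b0 r) simp
  also have "?a powr r = \<bar>N k * kl (weak k Y) (agg k Y)\<bar> powr (r / 2)"
    using nonneg[of k] k half by simp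
  also have "?b powr r = ((c_u u)\<^sup>2 * zbar K z k) powr (r / 2)"
    using zb c_u_nonneg by (subst half) (auto simp: real_sqrt_mult)
  finally show ?thesis by (simp add: mult_ac)
qed

end

section \<open>The oracle inequality\<close>

text \<open>Extracts the root in the Cauchy--Schwarz bound, where the expectation might a priori be
  infinite.\<close>

lemma ennreal_le_sqrt:
  assumes "a\<^sup>2 \<le> ennreal x" "0 \<le> x"
  shows "a \<le> ennreal (sqrt x)"
proof (cases a)
  case (real y)
  then have "y\<^sup>2 \<le> x" using assms by (simp add: ennreal_power)
  then show ?thesis using real by (auto intro!: ennreal_leI real_le_rsqrt)
next
  case top
  then show ?thesis using assms(1) by (simp add: power2_eq_square ennreal_top_mult top_unique)
qed

text \<open>Integrates \<open>powr_kl_oracle\<close>: its second term is deterministic, and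
  \<open>change_of_measure\<close> carries the first to the constant parameter \<theta>. As supports
  are nested, the statistic at scale \<open>k\<close> reads only coordinates in
  \<open>supp k\<close>, so the relevant bias is that of \<open>w k\<close>.\<close>

lemma (in aggregation) oracle_risk:
  fixes g :: "nat \<Rightarrow> real" and \<theta> \<Delta> r \<alpha> :: real
  assumes g: "\<And>i. g i \<in> \<Theta>" and \<theta>: "\<theta> \<in> \<Theta>" and k: "k \<in> {1..K}"
    and r: "0 < r" and \<alpha>: "0 < \<alpha>"
    and propag: "propagation_condition P q \<Theta> n K w Kag z r \<alpha>"
    and bias: "modeling_bias P q n g (w k) \<theta> \<le> ereal \<Delta>"
  shows "(\<integral>\<^sup>+Y. ennreal (\<bar>N k * KL P q (local_mle q \<Theta> n (w k) Y) (agg_est P q \<Theta> n w Kag z K Y)\<bar> powr (r / 2))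
            \<partial>joint_law P q n g)
         \<le> ennreal (2 powr max (r - 1) 0 * \<kappa> powr r *
              (sqrt (\<alpha> * tau r * exp \<Delta>) + ((c_u u)\<^sup>2 * zbar K z k) powr (r / 2)))"
proof -
  define h where "h Y = \<bar>N k * kl (weak k Y) (agg k Y)\<bar>" for Y
  define H where "H Y = ennreal (h Y powr (r / 2))" for Y
  define A where "A = 2 powr max (r - 1) 0 * \<kappa> powr r"
  define c where "c = ((c_u u)\<^sup>2 * zbar K z k) powr (r / 2)"
  have A0: "0 \<le> A" and c0: "0 \<le> c" by (simp_all add: A_def c_def)
  have at: "0 \<le> \<alpha> * tau r" using \<alpha> r by (simp add: tau_def Gamma_real_pos less_imp_le)
  have supp: "supp l \<subseteq> supp k" if "l \<in> {1..k}" for l using that k by (intro supp_mono) auto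
  have aggm: "agg k \<in> borel_measurable (PiM J (\<lambda>_. borel))" if "supp k \<subseteq> J" for J
    using that supp k by (intro agg_measurable[of k]) auto
  have Hm: "H \<in> borel_measurable (PiM J (\<lambda>_. borel))" if "supp k \<subseteq> J" for J
  proof -
    have "(\<lambda>Y. kl (weak k Y) (agg k Y)) \<in> borel_measurable (PiM J (\<lambda>_. borel))"
      using k by (intro kl_measurable mle_measurable aggm that mle_in agg_in) auto
    then show ?thesis unfolding H_def h_def by measurable
  qed
  have HJ: "H (restrict Y (supp k)) = H Y" for Y
  proof -
    have "agg k (restrict Y (supp k)) = agg k Y"
      using k by (intro agg_restrict[of k] supp) auto
    then show ?thesis by (simp only: H_def h_def mle_restrict[OF subset_refl])
  qed
  have moment: "(\<integral>\<^sup>+Y. (H Y)\<^sup>2 \<partial>joint_law P q n (\<lambda>_. \<theta>)) \<le> ennreal (\<alpha> * tau r)"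
  proof (cases "k = 1")
    \<comment> \<open>The propagation condition starts at scale \<open>2\<close>; at scale
      \<open>1\<close> the weak and the aggregated estimate coincide and the statistic is
      zero.\<close>
    case True
    then have "H Y = 0" for Y using r by (simp add: H_def h_def kl_self)
    then show ?thesis by simp
  next
    case False
    have "AE Y in joint_law P q n (\<lambda>_. \<theta>). (H Y)\<^sup>2 = ennreal (\<bar>weight_sum n (w k) *
          KL P q (local_mle q \<Theta> n (w k) Y) (agg_est P q \<Theta> n w Kag z k Y)\<bar> powr r)"
      using AE_joint_law_pos[OF \<theta>]
    proof eventually_elim
      case (elim Y)
      have "(h Y powr (r / 2))\<^sup>2 = h Y powr r"
        by (simp add: power2_eq_square powr_add[symmetric])
      then show ?case
        by (simp only: scaled_KL_eq[OF elim k k]) (simp add: H_def h_def ennreal_power)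
    qed
    then have "(\<integral>\<^sup>+Y. (H Y)\<^sup>2 \<partial>joint_law P q n (\<lambda>_. \<theta>)) =
        (\<integral>\<^sup>+Y. ennreal (\<bar>weight_sum n (w k) *
          KL P q (local_mle q \<Theta> n (w k) Y) (agg_est P q \<Theta> n w Kag z k Y)\<bar> powr r) \<partial>joint_law P q n (\<lambda>_. \<theta>))"
      by (rule nn_integral_cong_AE)
    also have "\<dots> \<le> (SUP t\<in>\<Theta>. \<integral>\<^sup>+Y. ennreal (\<bar>weight_sum n (w k) *
          KL P q (local_mle q \<Theta> n (w k) Y) (agg_est P q \<Theta> n w Kag z k Y)\<bar> powr r) \<partial>joint_law P q n (\<lambda>_. t))"
      by (rule SUP_upper[OF \<theta>])
    also have "\<dots> \<le> ennreal (\<alpha> * tau r)"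
      using propag k False unfolding propagation_condition_def by (auto dest!: bspec[of _ _ k])
    finally show ?thesis .
  qed
  have "(\<integral>\<^sup>+Y. H Y \<partial>joint_law P q n g)\<^sup>2 \<le> (\<integral>\<^sup>+Y. (H Y)\<^sup>2 \<partial>joint_law P q n (\<lambda>_. \<theta>)) *
    (\<Prod>i\<in>supp k. \<integral>\<^sup>+y. ennreal ((q y (g i))\<^sup>2 / (q y \<theta>)\<^sup>2) \<partial>law P q \<theta>)"
    by (rule change_of_measure[OF g \<theta> _ Hm[OF subset_refl] HJ]) auto
  also have "\<dots> \<le> ennreal (\<alpha> * tau r) * ennreal (exp \<Delta>)"
    by (rule mult_mono[OF moment prod_second_moment_le[OF bias]]) auto
  also have "\<dots> = ennreal (\<alpha> * tau r * exp \<Delta>)" using at by (simp add: ennreal_mult)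
  finally have HE: "(\<integral>\<^sup>+Y. H Y \<partial>joint_law P q n g) \<le> ennreal (sqrt (\<alpha> * tau r * exp \<Delta>))"
    using at by (intro ennreal_le_sqrt) auto
  interpret G: prob_space "joint_law P q n g"
    unfolding joint_law_def by (rule prob_space_PiM) (rule law_prob[OF g])
  have Hm': "H \<in> borel_measurable (joint_law P q n g)"
    unfolding joint_law_def measurable_PiM_law by (rule Hm) auto
  \<comment> \<open>The closed forms of the estimates hold where every \<open>p (Y i)\<close> is
    positive, hence almost surely. Measurability is used for the majorant \<open>H\<close>, not for
    the original integrand.\<close>
  have "AE Y in joint_law P q n g.
      ennreal (\<bar>N k * KL P q (local_mle q \<Theta> n (w k) Y) (agg_est P q \<Theta> n w Kag z K Y)\<bar> powr (r / 2))
        \<le> ennreal A * (H Y + ennreal c)"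
    using AE_joint_law_pos[OF g]
  proof eventually_elim
    case (elim Y)
    have K: "K \<in> {1..K}" using k by simp
    have "ennreal (\<bar>N k * kl (weak k Y) (agg K Y)\<bar> powr (r / 2)) \<le> ennreal (A * (h Y powr (r / 2) + c))"
      unfolding A_def c_def h_def by (intro ennreal_leI powr_kl_oracle k r)
    also have "\<dots> = ennreal A * (H Y + ennreal c)"
      using A0 c0 by (simp add: H_def ennreal_mult)
    finally show ?case by (simp only: scaled_KL_eq[OF elim k K])
  qed
  then have "(\<integral>\<^sup>+Y. ennreal (\<bar>N k * KL P q (local_mle q \<Theta> n (w k) Y) (agg_est P q \<Theta> n w Kag z K Y)\<bar> powr (r / 2))
      \<partial>joint_law P q n g) \<le> (\<integral>\<^sup>+Y. ennreal A * (H Y + ennreal c) \<partial>joint_law P q n g)"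
    by (rule nn_integral_mono_AE)
  also have "\<dots> = ennreal A * ((\<integral>\<^sup>+Y. H Y \<partial>joint_law P q n g) + ennreal c)"
    using Hm' by (simp add: nn_integral_cmult nn_integral_add G.emeasure_space_1)
  also have "\<dots> \<le> ennreal A * (ennreal (sqrt (\<alpha> * tau r * exp \<Delta>)) + ennreal c)"
    using HE by (intro mult_left_mono add_mono) auto
  also have "\<dots> = ennreal (A * (sqrt (\<alpha> * tau r * exp \<Delta>) + c))"
    using A0 c0 at by (simp add: ennreal_mult)
  finally show ?thesis unfolding A_def c_def .
qed

theorem theorem5p4:
  fixes P :: "real measure" and q :: "real \<Rightarrow> real \<Rightarrow> real" and \<Theta> :: "real set"
    and X :: "nat \<Rightarrow> real ^ 'd" and f :: "real ^ 'd \<Rightarrow> real"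
    and n K kstar :: nat and w :: "nat \<Rightarrow> nat \<Rightarrow> real"
    and Kag :: "real \<Rightarrow> real" and z :: "nat \<Rightarrow> real"
    and \<kappa> u0 u b r \<alpha> \<theta> \<Delta> :: real
  assumes "1 \<le> n" and "1 \<le> K"
    and "cond_A1 P q \<Theta>" and "cond_A2 P q \<Theta> \<kappa>"
    and "\<forall>x. f x \<in> \<Theta>"
    and "localizing_schemes n K w" and "cond_A3 n K w u0 u"
    and "agg_kernel Kag b" and "\<forall>k\<in>{1..K}. 0 < z k"
    and "0 < r" and "0 < \<alpha>"
    and "propagation_condition P q \<Theta> n K w Kag z r \<alpha>"
    and "kstar \<in> {1..K}" and "\<theta> \<in> \<Theta>" and "0 \<le> \<Delta>"
    and "(MAX k\<in>{1..kstar}. modeling_bias P q n (\<lambda>i. f (X i)) (w k) \<theta>) \<le> ereal \<Delta>"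
  shows "(\<integral>\<^sup>+Y. ennreal (\<bar>weight_sum n (w kstar) *
              KL P q (local_mle q \<Theta> n (w kstar) Y) (agg_est P q \<Theta> n w Kag z K Y)\<bar> powr (r / 2))
            \<partial>joint_law P q n (\<lambda>i. f (X i)))
         \<le> ennreal (2 powr max (r - 1) 0 * \<kappa> powr r *
              (sqrt (\<alpha> * tau r * exp \<Delta>) + ((c_u u)\<^sup>2 * zbar K z kstar) powr (r / 2)))"
proof -
  obtain p B C B' C' lo hi m where "regular_exp_family P q \<Theta> p B C B' C' lo hi m \<kappa>"
    using regular_exp_family_of_conds[OF assms(3,4)] \<open>\<theta> \<in> \<Theta>\<close> by blast
  then interpret regular_exp_family P q \<Theta> p B C B' C' lo hi m \<kappa> .
  interpret aggregation P q \<Theta> p B C B' C' lo hi m \<kappa> n K w u0 u Kag b z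
    using assms by unfold_locales auto
  have "modeling_bias P q n (\<lambda>i. f (X i)) (w kstar) \<theta>
      \<le> (MAX k\<in>{1..kstar}. modeling_bias P q n (\<lambda>i. f (X i)) (w k) \<theta>)"
    using \<open>kstar \<in> {1..K}\<close> by (intro Max_ge) auto
  also have "\<dots> \<le> ereal \<Delta>" by fact
  finally have bias: "modeling_bias P q n (\<lambda>i. f (X i)) (w kstar) \<theta> \<le> ereal \<Delta>" .
  have fX: "f (X i) \<in> \<Theta>" for i using assms(5) by blast
  show ?thesis
    by (rule oracle_risk[OF fX \<open>\<theta> \<in> \<Theta>\<close> \<open>kstar \<in> {1..K}\<close> \<open>0 < r\<close> \<open>0 < \<alpha>\<close> assms(12) bias])
qed

end
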